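(* Assume (a) $G_C=G$ does not depend on $C$; (b) $\mathbf X$ is finite and $\mathsf P_G(X_t=x)>0$ for all $x$; (c) $0<I(\theta,\vartheta\mid x)<\infty$ for all $\theta\ne\vartheta$ and all $x$; (d) $\Theta$ is finite; (e) (saddle point) for every configuration $(\theta_1,\theta_2)$ that is not implicitly revealing and has arm 2 preferred for every $x$, $$\inf_{\{\theta:\exists x_0,\ \mu_\theta(x_0)>\mu_{\theta_2}(x_0)\}}\sup_x I(\theta_1,\theta\mid x)=\sup_x\inf_{\{\theta:\exists x_0,\ \mu_\theta(x_0)>\mu_{\theta_2}(x_0)\}} I(\theta_1,\theta\mid x),$$ and symmetrically when arm 1 is preferred for every $x$. Then there exists an allocation rule $\{\phi_\tau\}$ such that: (1) for every implicitly revealing $C_0$, $\lim_{t\to\infty}\mathsf E_{C_0}\{T_{inf}(t)\}<\infty$; (2) for every $C_0=(\theta_1,\theta_2)$ that is not implicitly revealing (and has distinct arms), $\limsup_{t\to\infty}\mathsf E_{C_0}\{T_{inf}(t)\}/\log t\le 1/K_{C_0}$, where, if arm 2 is preferred for every $x$, $K_{C_0}=\inf_{\{\theta:\exists x_0,\ \mu_\theta(x_0)>\mu_{\theta_2}(x_0)\}}\sup_x I(\theta_1,\theta\mid x)$, and symmetrically if arm 1 is preferred.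
   Context: Two-armed bandit with side observations. $\Theta\subset\mathbb R$ is a parameter set and $\mathbf X\subset\mathbb R$. Known conditional distributions $\{F_\theta(dy\mid x)\}_{\theta\in\Theta}$ on $\mathbb R$ and a known law $G$ on $\mathbf X$. Under configuration $C_0=(\theta_1,\theta_2)\in\Theta^2$, $X_1,X_2,\dots$ are i.i.d. with law $G$, and for each arm $i$ the pairs $(X_t,Y^i_t)$ are i.i.d. with joint law $G(dx)F_{\theta_i}(dy\mid x)$. An allocation rule is $\phi_t\in\{1,2\}$ depending only on $X_1,\dots,X_t$ and previously observed rewards $Y^{\phi_\tau}_\tau$, $\tau<t$. $\mu_\theta(x)=\int yF_\theta(dy\mid x)$ (finite); $M_C(x)=\arg\max_i\mu_{i(C)}(x)$ with $1(C)=\theta_1,2(C)=\theta_2$. A configuration $C$ is implicitly revealing if there exist $x_1,x_2\in\mathbf X$ with $M_C(x_1)=1$ and $M_C(x_2)=2$; otherwise the preferred arm $M_C(x)$ is the same for all $x$. $T_{inf}(t)=\sum_{\tau\le t}1\{\phi_\tau\ne M_{C_0}(X_\tau)\}$. $I(\theta,\vartheta\mid x)$ is the Kullback–Leibler number between $F_\theta(\cdot\mid x)$ and $F_\vartheta(\cdot\mid x)$. Conventions: $\inf\emptyset=\infty$, $1/\infty=0$. *)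

theory Defs
  imports "HOL-Probability.Probability"
begin

text \<open>Conditional reward kernels: F :: real (parameter theta) => real (context x) => real measure.\<close>

definition mu :: "(real \<Rightarrow> real \<Rightarrow> real measure) \<Rightarrow> real \<Rightarrow> real \<Rightarrow> real" where
  "mu F th x = (\<integral>y. y \<partial>(F th x))"

definition KL :: "real measure \<Rightarrow> real measure \<Rightarrow> ereal" where
  "KL P Q = (if absolutely_continuous Q P \<and> integrable P (entropy_density (exp 1) Q P)
             then ereal (KL_divergence (exp 1) Q P) else \<infinity>)"

definition KLI :: "(real \<Rightarrow> real \<Rightarrow> real measure) \<Rightarrow> real \<Rightarrow> real \<Rightarrow> real \<Rightarrow> ereal" where
  "KLI F th vth x = KL (F th x) (F vth x)"

definition par :: "real \<times> real \<Rightarrow> nat \<Rightarrow> real" where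
  "par C i = (if i = 1 then fst C else snd C)"

definition pref :: "(real \<Rightarrow> real \<Rightarrow> real measure) \<Rightarrow> real \<times> real \<Rightarrow> real \<Rightarrow> nat set" where
  "pref F C x = {i \<in> {1, 2}. \<forall>j \<in> {1, 2}. mu F (par C j) x \<le> mu F (par C i) x}"

definition revealing :: "(real \<Rightarrow> real \<Rightarrow> real measure) \<Rightarrow> real set \<Rightarrow> real \<times> real \<Rightarrow> bool" where
  "revealing F Xs C \<longleftrightarrow> (\<exists>x1 \<in> Xs. \<exists>x2 \<in> Xs. 1 \<in> pref F C x1 \<and> 2 \<in> pref F C x2)"

definition Kinfsup :: "(real \<Rightarrow> real \<Rightarrow> real measure) \<Rightarrow> real set \<Rightarrow> real set \<Rightarrow> real \<Rightarrow> real \<Rightarrow> ereal" where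
  "Kinfsup F Th Xs bad good =
     (INF th \<in> {th \<in> Th. \<exists>x0 \<in> Xs. mu F th x0 > mu F good x0}. SUP x \<in> Xs. KLI F bad th x)"

definition Ksupinf :: "(real \<Rightarrow> real \<Rightarrow> real measure) \<Rightarrow> real set \<Rightarrow> real set \<Rightarrow> real \<Rightarrow> real \<Rightarrow> ereal" where
  "Ksupinf F Th Xs bad good =
     (SUP x \<in> Xs. INF th \<in> {th \<in> Th. \<exists>x0 \<in> Xs. mu F th x0 > mu F good x0}. KLI F bad th x)"

definition step :: "(real \<Rightarrow> real \<Rightarrow> real measure) \<Rightarrow> real pmf \<Rightarrow> real \<times> real
    \<Rightarrow> (real \<times> real \<times> real) measure" where
  "step F G C = measure_pmf G \<bind>
      (\<lambda>x. distr (F (fst C) x \<Otimes>\<^sub>M F (snd C) x) borel (\<lambda>(y1, y2). (x, y1, y2)))"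

definition Omega :: "(real \<Rightarrow> real \<Rightarrow> real measure) \<Rightarrow> real pmf \<Rightarrow> real \<times> real
    \<Rightarrow> (real \<times> real \<times> real) stream measure" where
  "Omega F G C = stream_space (step F G C)"

definition Xo :: "(real \<times> real \<times> real) stream \<Rightarrow> nat \<Rightarrow> real" where
  "Xo w t = fst (w !! t)"

definition Yo :: "nat \<Rightarrow> (real \<times> real \<times> real) stream \<Rightarrow> nat \<Rightarrow> real" where
  "Yo i w t = (if i = 1 then fst (snd (w !! t)) else snd (snd (w !! t)))"

text \<open>An allocation rule pi maps the observed history (X_tau, Y^{phi_tau}_tau), tau < t,
  and the current context X_t to an arm. hist is the observed history before time t.\<close>
fun hist :: "((real \<times> real) list \<Rightarrow> real \<Rightarrow> nat) \<Rightarrow> (real \<times> real \<times> real) stream \<Rightarrow> nat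
    \<Rightarrow> (real \<times> real) list" where
  "hist pol w 0 = []"
| "hist pol w (Suc t) = hist pol w t @ [(Xo w t, Yo (pol (hist pol w t) (Xo w t)) w t)]"

definition arm :: "((real \<times> real) list \<Rightarrow> real \<Rightarrow> nat) \<Rightarrow> (real \<times> real \<times> real) stream \<Rightarrow> nat \<Rightarrow> nat" where
  "arm pol w t = pol (hist pol w t) (Xo w t)"

definition Tinf :: "(real \<Rightarrow> real \<Rightarrow> real measure) \<Rightarrow> real \<times> real \<Rightarrow> ((real \<times> real) list \<Rightarrow> real \<Rightarrow> nat)
    \<Rightarrow> (real \<times> real \<times> real) stream \<Rightarrow> nat \<Rightarrow> nat" where
  "Tinf F C pol w t = card {tau. tau < t \<and> arm pol w tau \<notin> pref F C (Xo w tau)}"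

definition ETinf :: "(real \<Rightarrow> real \<Rightarrow> real measure) \<Rightarrow> real pmf \<Rightarrow> real \<times> real
    \<Rightarrow> ((real \<times> real) list \<Rightarrow> real \<Rightarrow> nat) \<Rightarrow> nat \<Rightarrow> real" where
  "ETinf F G C pol t = (\<integral>w. real (Tinf F C pol w t) \<partial>(Omega F G C))"

end

theory Submission
  imports Defs "HOL-Real_Asymp.Real_Asymp"
begin

text \<open>The rule computes the maximum likelihood estimate of each arm's parameter and calls an arm
  acceptable if it is optimal for the estimated configuration, or if that configuration is not
  implicitly revealing, the context is the one that best separates the inferior arm from the
  parameters that would make it optimal somewhere, and those parameters have not yet been rejected
  at level about \<open>1 / t\<close>. Among acceptable arms it pulls the less sampled one.

  For an additive statistic \<open>S\<close> of the observed data whose increments satisfy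
  \<open>E exp f \<le> 1\<close>, the process \<open>exp S\<close> is a supermartingale under any adaptive
  sampling, and if the bound is \<open>1 - \<delta>\<close> on pulls of a given arm, then the total expected
  weight \<open>exp S\<close> carried by those pulls is at most \<open>1 / \<delta>\<close>. Finiteness of the
  Kullback-Leibler numbers gives such bounds for small multiples of the log-likelihood ratio. Hence
  the expected number of pulls of an arm whose estimate is wrong is finite; an arm with at least
  half of the pulls has a wrong estimate only finitely often; and if the other arm has a wrong estimate
  and few pulls, then either it would be pulled in some context, which has positive probability, or
  its true parameter has been rejected, which has summable probability. What remains are the
  exploratory pulls at a correctly estimated configuration. These occur only if it is not revealing,
  and by the same weighting their number exceeds \<open>ln t / k\<close> by a bounded amount in expectation,
  for every \<open>k\<close> below the saddle value.\<close>

subsection \<open>Maximisers over a finite set\<close>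

lemma arg_max_on_finite:
  fixes f :: "'i \<Rightarrow> 'b::linorder"
  assumes "finite S" "S \<noteq> {}"
  shows arg_max_on_in: "arg_max_on f S \<in> S"
    and arg_max_on_greatest: "i \<in> S \<Longrightarrow> f i \<le> f (arg_max_on f S)"
proof -
  have "Max (f ` S) \<in> f ` S" using assms by simp
  then obtain m where "m \<in> S" "f m = Max (f ` S)" by auto
  then have "is_arg_max f (\<lambda>i. i \<in> S) m" using assms by (auto simp: is_arg_max_linorder)
  then have "is_arg_max f (\<lambda>i. i \<in> S) (arg_max_on f S)"
    unfolding arg_max_on_def arg_max_def by (rule someI)
  then show "arg_max_on f S \<in> S" "i \<in> S \<Longrightarrow> f i \<le> f (arg_max_on f S)"
    by (auto simp: is_arg_max_linorder)
qed

text \<open>The maximiser picked by \<^const>\<open>arg_max_on\<close> depends on the point only through the order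
  relation among the finitely many values.\<close>

lemma measurable_arg_max_on:
  fixes f :: "'i \<Rightarrow> 'a \<Rightarrow> 'b::{second_countable_topology, linorder_topology}"
  assumes finite_S: "finite S" and measurable_f: "\<And>i. i \<in> S \<Longrightarrow> f i \<in> borel_measurable M"
  shows "(\<lambda>x. arg_max_on (\<lambda>i. f i x) S) \<in> M \<rightarrow>\<^sub>M count_space UNIV"
proof -
  define R where "R x = {p \<in> S \<times> S. f (fst p) x \<le> f (snd p) x}" for x
  have arg_max_eq: "arg_max_on (\<lambda>i. f i x) S = (SOME i. i \<in> S \<and> (\<forall>j\<in>S. (j, i) \<in> R x))" for x
    unfolding arg_max_on_def arg_max_def is_arg_max_linorder R_def
    by (rule arg_cong[where f = Eps]) auto
  have fin_rel: "finite (Pow (S \<times> S))" using finite_S by simp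
  have "R \<in> M \<rightarrow>\<^sub>M count_space (Pow (S \<times> S))"
    unfolding measurable_count_space_eq2[OF fin_rel]
  proof (intro conjI ballI)
    fix Q assume "Q \<in> Pow (S \<times> S)"
    then have "R x = Q \<longleftrightarrow> (\<forall>p\<in>S \<times> S. p \<in> Q \<longleftrightarrow> f (fst p) x \<le> f (snd p) x)" for x
      unfolding R_def by blast
    then have "R -` {Q} \<inter> space M
        = {x \<in> space M. \<forall>p\<in>S \<times> S. p \<in> Q \<longleftrightarrow> f (fst p) x \<le> f (snd p) x}"
      by auto
    also have "\<dots> \<in> sets M"
    proof -
      have "Measurable.pred M (\<lambda>x. p \<in> Q \<longleftrightarrow> f (fst p) x \<le> f (snd p) x)" if "p \<in> S \<times> S" for p
      proof -
        have [measurable]: "f (fst p) \<in> borel_measurable M" "f (snd p) \<in> borel_measurable M"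
          using that measurable_f by auto
        show ?thesis by measurable
      qed
      then show ?thesis
        using finite_S by (intro predE pred_intros_finite) auto
    qed
    finally show "R -` {Q} \<inter> space M \<in> sets M" .
  qed (auto simp: R_def)
  from measurable_compose[OF this, of "\<lambda>Q. SOME i. i \<in> S \<and> (\<forall>j\<in>S. (j, i) \<in> Q)" "count_space UNIV"]
  have "(\<lambda>x. SOME i. i \<in> S \<and> (\<forall>j\<in>S. (j, i) \<in> R x)) \<in> M \<rightarrow>\<^sub>M count_space UNIV"
    by simp
  then show ?thesis unfolding arg_max_eq .
qed

subsection \<open>Resampling one entry of an i.i.d. stream\<close>

definition resample :: "'a stream \<Rightarrow> nat \<Rightarrow> 'a \<Rightarrow> 'a stream" where
  "resample w t s = stake t w @- s ## sdrop (Suc t) w"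

lemma resample_0: "resample w 0 s = s ## stl w"
  by (simp add: resample_def)

lemma resample_Suc: "resample (x ## w) (Suc t) s = x ## resample w t s"
  by (simp add: resample_def)

lemma snth_resample: "resample w t s !! u = (if u = t then s else w !! u)"
proof (induction t arbitrary: w u)
  case 0
  then show ?case by (cases u) (auto simp: resample_0)
next
  case (Suc t)
  show ?case
    using Suc[of "stl w"] resample_Suc[of "shd w" "stl w" t s] by (cases u) auto
qed

lemma measurable_resample [measurable (raw)]:
  assumes [measurable]: "f \<in> N \<rightarrow>\<^sub>M stream_space M" "g \<in> N \<rightarrow>\<^sub>M M"
  shows "(\<lambda>z. resample (f z) t (g z)) \<in> N \<rightarrow>\<^sub>M stream_space M"
  by (rule measurable_stream_space2) (simp add: snth_resample)

lemma (in prob_space) nn_integral_resample: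
  assumes "f \<in> borel_measurable (stream_space M)"
  shows "(\<integral>\<^sup>+w. f w \<partial>stream_space M) = (\<integral>\<^sup>+w. \<integral>\<^sup>+s. f (resample w t s) \<partial>M \<partial>stream_space M)"
  using assms
proof (induction t arbitrary: f)
  case 0
  note [measurable] = 0
  interpret S: prob_space "stream_space M" by (rule prob_space_stream_space)
  interpret P: pair_sigma_finite M "stream_space M" by unfold_locales
  have "(\<integral>\<^sup>+w. \<integral>\<^sup>+s. f (resample w 0 s) \<partial>M \<partial>stream_space M)
      = (\<integral>\<^sup>+x. \<integral>\<^sup>+w. \<integral>\<^sup>+s. f (s ## w) \<partial>M \<partial>stream_space M \<partial>M)"
    by (subst nn_integral_stream_space) (auto simp: resample_0)
  also have "\<dots> = (\<integral>\<^sup>+w. \<integral>\<^sup>+s. f (s ## w) \<partial>M \<partial>stream_space M)"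
    by (simp add: emeasure_space_1)
  also have "\<dots> = (\<integral>\<^sup>+s. \<integral>\<^sup>+w. f (s ## w) \<partial>stream_space M \<partial>M)"
    by (rule P.Fubini') simp
  also have "\<dots> = (\<integral>\<^sup>+w. f w \<partial>stream_space M)"
    by (simp add: nn_integral_stream_space)
  finally show ?case by simp
next
  case (Suc t)
  note [measurable] = Suc.prems
  have "(\<integral>\<^sup>+w. \<integral>\<^sup>+s. f (resample w (Suc t) s) \<partial>M \<partial>stream_space M)
     = (\<integral>\<^sup>+x. \<integral>\<^sup>+w. \<integral>\<^sup>+s. f (x ## resample w t s) \<partial>M \<partial>stream_space M \<partial>M)"
    by (subst nn_integral_stream_space) (auto simp: resample_Suc)
  also have "\<dots> = (\<integral>\<^sup>+x. \<integral>\<^sup>+w. f (x ## w) \<partial>stream_space M \<partial>M)"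
    by (rule nn_integral_cong, rule Suc.IH[symmetric]) simp
  also have "\<dots> = (\<integral>\<^sup>+w. f w \<partial>stream_space M)"
    by (simp add: nn_integral_stream_space)
  finally show ?case by simp
qed

subsection \<open>Sequences of events with summable probabilities\<close>

context prob_space
begin

definition summable_events :: "(nat \<Rightarrow> 'a \<Rightarrow> bool) \<Rightarrow> bool" where
  "summable_events E \<longleftrightarrow> (\<forall>t. Measurable.pred M (E t)) \<and> summable (\<lambda>t. \<P>(w in M. E t w))"

lemma prob_le_nn_integral:
  assumes [measurable]: "Measurable.pred M P" and nonneg: "0 \<le> c"
    and lower: "\<And>w. P w \<Longrightarrow> ennreal c \<le> g w"
  shows "ennreal (c * \<P>(w in M. P w)) \<le> (\<integral>\<^sup>+w. g w \<partial>M)"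
proof -
  have "ennreal (c * \<P>(w in M. P w)) = (\<integral>\<^sup>+w. ennreal c * indicator {w \<in> space M. P w} w \<partial>M)"
    using nonneg by (simp add: nn_integral_cmult_indicator emeasure_eq_measure ennreal_mult)
  also have "\<dots> \<le> (\<integral>\<^sup>+w. g w \<partial>M)"
    using lower by (intro nn_integral_mono) (simp add: indicator_def)
  finally show ?thesis .
qed

lemma summable_events_subset:
  assumes "summable_events E" and [measurable]: "\<And>t. Measurable.pred M (E' t)"
    and subset: "\<And>t w. E' t w \<Longrightarrow> E t w"
  shows "summable_events E'"
proof -
  have [measurable]: "Measurable.pred M (E t)" for t
    using assms(1) by (simp add: summable_events_def)
  have "summable (\<lambda>t. \<P>(w in M. E t w))"
    using assms(1) by (simp add: summable_events_def)
  then have "summable (\<lambda>t. \<P>(w in M. E' t w))"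
    by (rule summable_comparison_test') (auto intro!: finite_measure_mono subset)
  then show ?thesis by (simp add: summable_events_def assms(2))
qed

lemma prob_disj_le:
  assumes [measurable]: "Measurable.pred M P" "Measurable.pred M Q"
  shows "\<P>(w in M. P w \<or> Q w) \<le> \<P>(w in M. P w) + \<P>(w in M. Q w)"
proof -
  have "{w \<in> space M. P w \<or> Q w} = {w \<in> space M. P w} \<union> {w \<in> space M. Q w}" by blast
  then show ?thesis by (simp add: measure_Un_le)
qed

lemma summable_events_disj:
  assumes "summable_events E" "summable_events E'"
  shows "summable_events (\<lambda>t w. E t w \<or> E' t w)"
proof -
  have [measurable]: "Measurable.pred M (E t)" "Measurable.pred M (E' t)" for t
    using assms by (auto simp: summable_events_def)
  have "summable (\<lambda>t. \<P>(w in M. E t w) + \<P>(w in M. E' t w))"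
    using assms by (intro summable_add) (auto simp: summable_events_def)
  then have "summable (\<lambda>t. \<P>(w in M. E t w \<or> E' t w))"
    by (rule summable_comparison_test') (simp add: prob_disj_le)
  then show ?thesis by (simp add: summable_events_def)
qed

lemma summable_events_Bex:
  assumes "finite I" "\<And>i. i \<in> I \<Longrightarrow> summable_events (E i)"
  shows "summable_events (\<lambda>t w. \<exists>i\<in>I. E i t w)"
  using assms
proof (induction I rule: finite_induct)
  case empty
  show ?case by (simp add: summable_events_def)
next
  case (insert i I)
  then show ?case by (auto intro: summable_events_disj)
qed

lemma sum_prob_disj_summable_le:
  assumes [measurable]: "\<And>t. Measurable.pred M (Q t)" and summable_E: "summable_events E"
  shows "(\<Sum>t<n. \<P>(w in M. Q t w \<or> E t w)) \<le> (\<Sum>t<n. \<P>(w in M. Q t w)) + (\<Sum>t. \<P>(w in M. E t w))"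
proof -
  have [measurable]: "Measurable.pred M (E t)" for t
    using summable_E by (simp add: summable_events_def)
  have "(\<Sum>t<n. \<P>(w in M. Q t w \<or> E t w)) \<le> (\<Sum>t<n. \<P>(w in M. Q t w) + \<P>(w in M. E t w))"
    by (intro sum_mono prob_disj_le) measurable
  also have "\<dots> \<le> (\<Sum>t<n. \<P>(w in M. Q t w)) + (\<Sum>t. \<P>(w in M. E t w))"
    unfolding sum.distrib
    using summable_E by (intro add_left_mono sum_le_suminf) (auto simp: summable_events_def)
  finally show ?thesis .
qed

lemma integrable_of_bool: "Measurable.pred M P \<Longrightarrow> integrable M (\<lambda>w. of_bool (P w) :: real)"
  by (rule integrable_const_bound[where B = 1]) (auto simp: of_bool_def)

lemma expectation_of_bool:
  assumes "Measurable.pred M P"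
  shows "expectation (\<lambda>w. of_bool (P w)) = \<P>(w in M. P w)"
proof -
  have "expectation (\<lambda>w. of_bool (P w)) = expectation (indicator {w \<in> space M. P w})"
    by (rule Bochner_Integration.integral_cong) auto
  also have "\<dots> = \<P>(w in M. P w)"
    unfolding Bochner_Integration.integral_indicator by (rule arg_cong[where f = prob]) auto
  finally show ?thesis .
qed

lemma expectation_count:
  assumes "\<And>t. Measurable.pred M (E t)"
  shows "expectation (\<lambda>w. \<Sum>t<n. of_bool (E t w)) = (\<Sum>t<n. \<P>(w in M. E t w))"
  by (simp add: Bochner_Integration.integral_sum integrable_of_bool expectation_of_bool assms
      del: sum_of_bool_eq)

lemma sum_prob_le_count_bound:
  assumes "\<And>t. Measurable.pred M (E t)" and count: "\<And>w. (\<Sum>t<n. of_bool (E t w)) \<le> b"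
  shows "(\<Sum>t<n. \<P>(w in M. E t w)) \<le> b"
  unfolding expectation_count[OF assms(1), symmetric]
  by (rule integral_le_const)
    (auto intro!: Bochner_Integration.integrable_sum integrable_of_bool assms(1) count)

end

lemma sum_of_bool_count_less_le:
  fixes m :: real and n :: nat
  assumes "0 \<le> m"
  shows "(\<Sum>t<n. of_bool (P t \<and> (\<Sum>u<t. of_bool (P u)) < m)) \<le> m + 1"
proof -
  have "(\<Sum>t<n. of_bool (P t \<and> (\<Sum>u<t. of_bool (P u)) < m)) \<le> min (\<Sum>u<n. of_bool (P u)) (m + 1)"
  proof (induction n)
    case (Suc n)
    have "0 \<le> (\<Sum>u<n. of_bool (P u) :: real)" by (intro sum_nonneg) simp
    with Suc assms show ?case
      by (cases "P n"; cases "(\<Sum>u<n. of_bool (P u)) < m") auto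
  qed (use assms in simp)
  then show ?thesis by simp
qed

subsection \<open>The rejection threshold\<close>

text \<open>The logarithmic factor makes the reciprocals summable without changing the asymptotics of
  the logarithm.\<close>

definition threshold :: "nat \<Rightarrow> real" where
  "threshold t = real (t + 1) * (1 + ln (real (t + 1)))\<^sup>2"

lemma threshold_ge_1: "1 \<le> threshold t"
proof -
  have "1 * 1 \<le> threshold t" unfolding threshold_def
    by (rule mult_mono) (auto intro!: one_le_power)
  then show ?thesis by simp
qed

lemma threshold_mono: "t \<le> u \<Longrightarrow> threshold t \<le> threshold u"
  unfolding threshold_def by (intro mult_mono power_mono add_left_mono) (auto intro!: ln_mono)

lemma ln_threshold_mono: "t \<le> u \<Longrightarrow> ln (threshold t) \<le> ln (threshold u)"
  using threshold_ge_1[of t] by (intro ln_mono threshold_mono) auto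

lemma summable_inverse_threshold: "summable (\<lambda>t. 1 / threshold t)"
proof (rule summable_comparison_test_bigo)
  define f where "f t = 1 / (1 + ln (real t + 1))" for t :: nat
  have "f (Suc t) \<le> f t" for t by (simp add: f_def field_simps add_pos_nonneg)
  moreover have "f \<longlonglongrightarrow> 0" unfolding f_def by real_asymp
  ultimately show "summable (\<lambda>t. norm (f t - f (Suc t)))"
    by (auto intro: telescope_summable')
  show "(\<lambda>t. 1 / threshold t) \<in> O(\<lambda>t. f t - f (Suc t))"
    unfolding threshold_def f_def by real_asymp
qed

lemma ln_threshold_asymp: "(\<lambda>t. (b + ln (threshold t) / k) / ln (real t)) \<longlonglongrightarrow> 1 / k"
proof -
  have "(\<lambda>t. b / ln (real t) + (ln (threshold t) / ln (real t)) * (1 / k)) \<longlonglongrightarrow> 0 + 1 * (1 / k)"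
    unfolding threshold_def by (intro tendsto_intros; real_asymp)
  then show ?thesis by (simp add: add_divide_distrib mult.commute)
qed

lemma limsup_div_ln_le:
  fixes e :: "nat \<Rightarrow> real"
  assumes "\<And>t. e t \<le> b + ln (threshold t) / k"
  shows "limsup (\<lambda>t. ereal (e t / ln (real t))) \<le> ereal (1 / k)"
proof -
  have "limsup (\<lambda>t. ereal (e t / ln (real t)))
      \<le> limsup (\<lambda>t. ereal ((b + ln (threshold t) / k) / ln (real t)))"
    by (rule Limsup_mono, rule eventually_mono[OF eventually_ge_at_top[of 1]])
      (auto intro!: divide_right_mono assms)
  also have "\<dots> = ereal (1 / k)"
    by (rule lim_imp_Limsup) (auto intro: ln_threshold_asymp)
  finally show ?thesis .
qed

lemma ereal_le_divide_1I:
  fixes K L :: ereal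
  assumes K_pos: "0 < K" and upper: "\<And>k. 0 < k \<Longrightarrow> ereal k < K \<Longrightarrow> L \<le> ereal (1 / k)"
  shows "L \<le> 1 / K"
proof (rule ccontr)
  assume "\<not> L \<le> 1 / K"
  then obtain r where r_between: "1 / K < ereal r" "ereal r < L"
    using ereal_dense2[of "1 / K" L] by (auto simp: not_le)
  have "0 \<le> 1 / K" using K_pos by simp
  then have r_pos: "0 < r" using r_between(1) by (metis ereal_less(2) le_less_trans)
  moreover have "ereal (1 / r) < K"
    using K_pos r_between(1) r_pos by (cases K) (auto simp: field_simps one_ereal_def)
  ultimately have "L \<le> ereal r" using upper[of "1 / r"] by simp
  then show False using r_between(2) by simp
qed

subsection \<open>Log-densities and Kullback-Leibler divergence\<close>

lemma density_exp_entropy_density: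
  assumes N: "sigma_finite_measure N" and P: "sigma_finite_measure P" "sets P = sets N"
    and abs_cont: "absolutely_continuous N P" "absolutely_continuous P N"
  shows "density N (\<lambda>y. ennreal (exp (entropy_density (exp 1) N P y))) = P"
proof -
  interpret sigma_finite_measure N by fact
  have P_eq: "density N (RN_deriv N P) = P" by (rule density_RN_deriv[OF abs_cont(1) P(2)])
  have "AE y in density N (RN_deriv N P). RN_deriv N P y \<noteq> 0" by (subst AE_density) auto
  then have "AE y in N. RN_deriv N P y \<noteq> 0"
    unfolding P_eq by (rule absolutely_continuous_AE[OF P(2)[symmetric] abs_cont(2)])
  moreover have "AE y in N. RN_deriv N P y \<noteq> \<infinity>"
    by (rule RN_deriv_finite[OF P(1) abs_cont(1) P(2)])
  ultimately have "AE y in N. ennreal (exp (entropy_density (exp 1) N P y)) = RN_deriv N P y"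
  proof eventually_elim
    case (elim y)
    then have "0 < enn2real (RN_deriv N P y)"
      by (simp add: enn2real_positive_iff top.not_eq_extremum zero_less_iff_neq_zero)
    then show ?case
      using elim by (simp add: entropy_density_def log_def ennreal_enn2real_if)
  qed
  then have "density N (\<lambda>y. ennreal (exp (entropy_density (exp 1) N P y)))
      = density N (RN_deriv N P)"
    by (intro density_cong) simp_all
  then show ?thesis by (simp add: P_eq)
qed

lemma nn_integral_exp_log_density_diff:
  assumes [measurable]: "a \<in> borel_measurable N" "b \<in> borel_measurable N"
    and P_density: "P = density N (\<lambda>y. ennreal (exp (a y)))"
    and Q_density: "Q = density N (\<lambda>y. ennreal (exp (b y)))" "prob_space Q"
  shows "(\<integral>\<^sup>+y. ennreal (exp (b y - a y)) \<partial>P) = 1"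
proof -
  have "(\<integral>\<^sup>+y. ennreal (exp (b y - a y)) \<partial>P) = (\<integral>\<^sup>+y. ennreal (exp (b y)) \<partial>N)"
    unfolding P_density by (subst nn_integral_density)
      (auto simp: ennreal_mult[symmetric] exp_add[symmetric] intro!: nn_integral_cong)
  also have "\<dots> = emeasure Q (space Q)"
    unfolding Q_density(1) by (simp add: emeasure_density cong: nn_integral_cong)
  finally show ?thesis using prob_space.emeasure_space_1[OF Q_density(2)] by simp
qed

lemma AE_entropy_density_eq_log_density_diff:
  assumes [measurable]: "a \<in> borel_measurable N" "b \<in> borel_measurable N"
    and P_density: "P = density N (\<lambda>y. ennreal (exp (a y)))"
    and Q_density: "Q = density N (\<lambda>y. ennreal (exp (b y)))" "sigma_finite_measure Q"
    and abs_cont: "absolutely_continuous Q P"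
  shows "AE y in P. entropy_density (exp 1) Q P y = a y - b y"
proof -
  interpret sigma_finite_measure Q by fact
  have sets_eq [measurable_cong]: "sets P = sets N" "sets Q = sets N"
    by (simp_all add: P_density Q_density)
  have "density Q (\<lambda>y. ennreal (exp (a y - b y))) = P"
    unfolding Q_density(1) P_density by (subst density_density_eq)
      (auto simp: ennreal_mult[symmetric] exp_add[symmetric] intro!: density_cong)
  then have "AE y in Q. ennreal (exp (a y - b y)) = RN_deriv Q P y"
    by (intro RN_deriv_unique) measurable
  then have "AE y in P. ennreal (exp (a y - b y)) = RN_deriv Q P y"
    by (rule absolutely_continuous_AE[rotated 2]) (simp_all add: sets_eq abs_cont)
  then show ?thesis
  proof eventually_elim
    case (elim y)
    show ?case by (simp add: entropy_density_def log_def flip: elim)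
  qed
qed

lemma KL_finiteD:
  assumes "KL P Q < \<infinity>"
  shows "absolutely_continuous Q P" "integrable P (entropy_density (exp 1) Q P)"
    "KL P Q = ereal (KL_divergence (exp 1) Q P)"
  using assms by (auto simp: KL_def split: if_splits)

lemma KL_eq_integral_log_density_diff:
  fixes N P Q :: "real measure"
  assumes [measurable]: "a \<in> borel_measurable N" "b \<in> borel_measurable N"
    and P_density: "P = density N (\<lambda>y. ennreal (exp (a y)))"
    and Q_density: "Q = density N (\<lambda>y. ennreal (exp (b y)))" "sigma_finite_measure Q"
    and KL_finite: "KL P Q < \<infinity>"
  shows "integrable P (\<lambda>y. a y - b y)" "KL P Q = ereal (\<integral>y. a y - b y \<partial>P)"
proof -
  have sets_eq [measurable_cong]: "sets P = sets N" "sets Q = sets N"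
    by (simp_all add: P_density Q_density)
  have density_eq: "AE y in P. entropy_density (exp 1) Q P y = a y - b y"
    by (rule AE_entropy_density_eq_log_density_diff[OF assms(1,2) P_density Q_density])
      (rule KL_finiteD(1)[OF KL_finite])
  have [measurable]: "entropy_density (exp 1) Q P \<in> borel_measurable P"
    using measurable_entropy_density[of "exp 1" Q P]
    by (simp add: measurable_cong_sets[of P Q] sets_eq)
  show "integrable P (\<lambda>y. a y - b y)"
    using KL_finiteD(2)[OF KL_finite] by (rule integrable_cong_AE_imp) (use density_eq in auto)
  show "KL P Q = ereal (\<integral>y. a y - b y \<partial>P)"
    unfolding KL_finiteD(3)[OF KL_finite] KL_divergence_def
    using density_eq by (auto intro!: integral_cong_AE)
qed

subsection \<open>The moment generating function near the origin\<close>

lemma abs_exp_difference_quotient_le: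
  fixes r s :: real
  assumes "0 < s" "s \<le> 1"
  shows "\<bar>(exp (s * r) - 1) / s\<bar> \<le> \<bar>r\<bar> + exp r"
proof -
  have lower: "r \<le> (exp (s * r) - 1) / s"
    using exp_ge_add_one_self[of "s * r"] assms by (simp add: field_simps)
  have "exp ((1 - s) *\<^sub>R 0 + s *\<^sub>R r) \<le> (1 - s) * exp 0 + s * exp r"
    using assms by (intro convex_onD[OF exp_convex]) auto
  then have upper: "(exp (s * r) - 1) / s \<le> exp r - 1" using assms by (simp add: field_simps)
  show ?thesis using lower upper exp_gt_zero[of r] by linarith
qed

text \<open>Only a first moment of \<open>r\<close> is assumed, but \<open>exp r\<close> is integrable, and this is enough to
  differentiate the moment generating function from the right at \<open>0\<close>.\<close>

lemma tendsto_integral_exp_difference_quotient: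
  fixes r :: "'a \<Rightarrow> real"
  assumes integrable_r: "integrable M r" and integrable_exp: "integrable M (\<lambda>y. exp (r y))"
  shows "((\<lambda>s. \<integral>y. (exp (s * r y) - 1) / s \<partial>M) \<longlongrightarrow> (\<integral>y. r y \<partial>M)) (at_right 0)"
proof (rule tendsto_at_right_sequentially[of 0 1])
  fix s :: "nat \<Rightarrow> real"
  assume s_null: "\<And>n. 0 < s n" "\<And>n. s n < 1" "s \<longlonglongrightarrow> 0"
  have [measurable]: "r \<in> borel_measurable M" using integrable_r by auto
  have "((\<lambda>h. (exp (h * r y) - 1) / h) \<longlongrightarrow> r y) (at 0)" for y
  proof -
    have "((\<lambda>h. exp (h * r y)) has_real_derivative r y) (at 0)"
      by (auto intro!: derivative_eq_intros)
    then show ?thesis by (simp add: has_field_derivative_iff)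
  qed
  moreover have "filterlim s (at 0) sequentially"
    using s_null by (auto simp: filterlim_at less_imp_neq[symmetric])
  ultimately have pointwise: "(\<lambda>n. (exp (s n * r y) - 1) / s n) \<longlonglongrightarrow> r y" for y
    by (rule filterlim_compose)
  have dominated: "norm ((exp (s n * r y) - 1) / s n) \<le> \<bar>r y\<bar> + exp (r y)" for n y
    using abs_exp_difference_quotient_le[of "s n" "r y"] s_null(1,2)[of n] by simp
  show "(\<lambda>n. \<integral>y. (exp (s n * r y) - 1) / s n \<partial>M) \<longlonglongrightarrow> (\<integral>y. r y \<partial>M)"
  proof (rule integral_dominated_convergence)
    show "integrable M (\<lambda>y. \<bar>r y\<bar> + exp (r y))" using integrable_r integrable_exp by auto
  qed (use pointwise dominated in auto)
qed simp

lemma (in prob_space) eventually_nn_integral_exp_le: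
  fixes r :: "'a \<Rightarrow> real"
  assumes integrable_r: "integrable M r" and integrable_exp: "integrable M (\<lambda>y. exp (r y))"
    and k_less: "k < - expectation r"
  shows "\<forall>\<^sub>F s in at_right 0. (\<integral>\<^sup>+y. ennreal (exp (s * r y)) \<partial>M) \<le> ennreal (exp (- (s * k)))"
proof -
  have [measurable]: "r \<in> borel_measurable M" using integrable_r by auto
  have "\<forall>\<^sub>F s in at_right 0. (\<integral>y. (exp (s * r y) - 1) / s \<partial>M) < - k"
    using tendsto_integral_exp_difference_quotient[OF integrable_r integrable_exp]
    by (rule order_tendstoD(2)) (use k_less in simp)
  moreover have "\<forall>\<^sub>F s in at_right 0. 0 < s \<and> s < (1::real)"
    using eventually_at_right_real[OF zero_less_one] by eventually_elim auto
  ultimately show ?thesis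
  proof eventually_elim
    case (elim s)
    define q where "q y = (exp (s * r y) - 1) / s" for y
    have exp_eq: "exp (s * r y) = 1 + s * q y" for y using elim by (simp add: q_def)
    have integrable_q: "integrable M q"
    proof (rule Bochner_Integration.integrable_bound)
      show "integrable M (\<lambda>y. \<bar>r y\<bar> + exp (r y))" using integrable_r integrable_exp by auto
      show "AE y in M. norm (q y) \<le> norm (\<bar>r y\<bar> + exp (r y))"
        using abs_exp_difference_quotient_le[of s] elim by (intro AE_I2) (simp add: q_def)
    qed (unfold q_def, measurable)
    have "(\<integral>\<^sup>+y. ennreal (exp (s * r y)) \<partial>M) = ennreal (\<integral>y. exp (s * r y) \<partial>M)"
    proof (rule nn_integral_eq_integral)
      show "integrable M (\<lambda>y. exp (s * r y))" unfolding exp_eq using integrable_q by simp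
    qed simp
    also have "(\<integral>y. exp (s * r y) \<partial>M) = 1 + s * (\<integral>y. q y \<partial>M)"
      unfolding exp_eq using integrable_q by (simp add: prob_space)
    also have "\<dots> \<le> 1 + s * (- k)"
      using elim by (intro add_left_mono mult_left_mono) (auto simp: q_def)
    also have "\<dots> \<le> exp (- (s * k))"
      using exp_ge_add_one_self[of "- (s * k)"] by simp
    finally show ?case by (simp add: ennreal_leI)
  qed
qed

subsection \<open>The law of one round\<close>

lemma bind_measure_pmf_cong_sets:
  assumes agree: "\<And>x. x \<in> set_pmf p \<Longrightarrow> f x = g x"
    and sets_eq: "\<And>x. sets (f x) = sets N" "\<And>x. sets (g x) = sets N"
  shows "measure_pmf p \<bind> f = measure_pmf p \<bind> g"
proof -
  have "emeasure (measure_pmf p) (f -` A) = emeasure (measure_pmf p) (g -` A)" for A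
    by (rule emeasure_eq_AE) (auto simp: AE_measure_pmf_iff agree)
  then have "distr (measure_pmf p) (subprob_algebra N) f
      = distr (measure_pmf p) (subprob_algebra N) g"
    by (simp add: distr_def)
  moreover have "subprob_algebra (f x) = subprob_algebra N"
    "subprob_algebra (g x) = subprob_algebra N" for x
    using sets_eq by (auto intro: subprob_algebra_cong)
  ultimately show ?thesis by (simp add: bind_def)
qed

locale bandit_env =
  fixes Xs :: "real set" and F :: "real \<Rightarrow> real \<Rightarrow> real measure" and G :: "real pmf"
    and C :: "real \<times> real"
  assumes prob_space_F: "x \<in> Xs \<Longrightarrow> prob_space (F (par C a) x)"
    and sets_F: "x \<in> Xs \<Longrightarrow> sets (F (par C a) x) = sets borel"
    and set_pmf_G: "set_pmf G \<subseteq> Xs"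
    and finite_Xs: "finite Xs"
begin

lemma sets_Xs: "Xs \<in> sets borel"
  using finite_Xs by (simp add: finite_imp_closed borel_closed)

text \<open>Off \<open>Xs\<close> the kernels \<open>F\<close> are arbitrary, and the bind in \<^const>\<open>step\<close> may be over a
  non-measurable map; replacing \<open>F\<close> by a point mass there does not change the bind.\<close>

definition reward_law :: "nat \<Rightarrow> real \<Rightarrow> real measure" where
  "reward_law a x = (if x \<in> Xs then F (par C a) x else return borel 0)"

definition round_law :: "real \<Rightarrow> (real \<times> real \<times> real) measure" where
  "round_law x = distr (reward_law 1 x \<Otimes>\<^sub>M reward_law 2 x) borel (\<lambda>(y1, y2). (x, y1, y2))"

lemma prob_space_reward_law: "prob_space (reward_law a x)"
  by (auto simp: reward_law_def prob_space_F intro: prob_space_return)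

lemma sets_reward_law [measurable_cong]: "sets (reward_law a x) = sets borel"
  by (simp add: reward_law_def sets_F)

lemma sets_round_law: "sets (round_law x) = sets borel"
  by (simp add: round_law_def)

lemma measurable_round [measurable]:
  "(\<lambda>(y1, y2). (x, y1, y2)) \<in> reward_law a x \<Otimes>\<^sub>M reward_law b x \<rightarrow>\<^sub>M borel"
  by (simp add: split_beta' borel_prod[symmetric])

lemma prob_space_round_law: "prob_space (round_law x)"
proof -
  interpret A: prob_space "reward_law 1 x" by (rule prob_space_reward_law)
  interpret B: prob_space "reward_law 2 x" by (rule prob_space_reward_law)
  interpret P: pair_prob_space "reward_law 1 x" "reward_law 2 x" ..
  show ?thesis unfolding round_law_def by (rule P.prob_space_distr) measurable
qed

lemma measurable_round_law: "round_law \<in> measure_pmf G \<rightarrow>\<^sub>M subprob_algebra borel"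
  using prob_space_round_law
  by (auto simp: space_subprob_algebra sets_round_law intro: prob_space_imp_subprob_space)

lemma step_eq_bind: "step F G C = measure_pmf G \<bind> round_law"
  unfolding step_def
proof (rule bind_measure_pmf_cong_sets[where N = borel])
  fix x assume "x \<in> set_pmf G"
  then show "distr (F (fst C) x \<Otimes>\<^sub>M F (snd C) x) borel (\<lambda>(y1, y2). (x, y1, y2)) = round_law x"
    using set_pmf_G by (auto simp: round_law_def reward_law_def par_def)
qed (simp_all add: sets_round_law)

lemma sets_step: "sets (step F G C) = sets borel"
  unfolding step_eq_bind by (rule sets_bind) (auto simp: sets_round_law)

lemma prob_space_step: "prob_space (step F G C)"
  unfolding step_eq_bind
  by (rule prob_space.prob_space_bind[OF prob_space_measure_pmf _ measurable_round_law])
    (simp add: prob_space_round_law)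

lemma nn_integral_step:
  assumes [measurable]: "g \<in> borel_measurable borel"
  shows "(\<integral>\<^sup>+s. g s \<partial>step F G C)
    = (\<integral>\<^sup>+x. \<integral>\<^sup>+y1. \<integral>\<^sup>+y2. g (x, y1, y2) \<partial>reward_law 2 x \<partial>reward_law 1 x \<partial>measure_pmf G)"
proof -
  have "(\<integral>\<^sup>+s. g s \<partial>round_law x)
      = (\<integral>\<^sup>+y1. \<integral>\<^sup>+y2. g (x, y1, y2) \<partial>reward_law 2 x \<partial>reward_law 1 x)" for x
  proof -
    interpret B: prob_space "reward_law 2 x" by (rule prob_space_reward_law)
    have g_round: "(\<lambda>z. g (case z of (y1, y2) \<Rightarrow> (x, y1, y2)))
        \<in> borel_measurable (reward_law 1 x \<Otimes>\<^sub>M reward_law 2 x)"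
      by (rule measurable_compose[OF measurable_round assms])
    have "(\<integral>\<^sup>+s. g s \<partial>round_law x)
        = (\<integral>\<^sup>+z. g (case z of (y1, y2) \<Rightarrow> (x, y1, y2)) \<partial>(reward_law 1 x \<Otimes>\<^sub>M reward_law 2 x))"
      unfolding round_law_def by (rule nn_integral_distr) measurable
    also have "\<dots> = (\<integral>\<^sup>+y1. \<integral>\<^sup>+y2. g (x, y1, y2) \<partial>reward_law 2 x \<partial>reward_law 1 x)"
      by (subst B.nn_integral_fst[OF g_round, symmetric]) simp
    finally show ?thesis .
  qed
  then show ?thesis
    unfolding step_eq_bind by (simp add: nn_integral_bind[OF assms measurable_round_law])
qed

lemma nn_integral_reward_law_arm:
  assumes [measurable]: "g \<in> borel_measurable borel"
  shows "(\<integral>\<^sup>+y1. \<integral>\<^sup>+y2. g (if a = 1 then y1 else y2) \<partial>reward_law 2 x \<partial>reward_law 1 x)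
    = (\<integral>\<^sup>+y. g y \<partial>reward_law a x)"
proof -
  have "(\<integral>\<^sup>+y. c \<partial>reward_law b x) = c" for b c
    using prob_space.emeasure_space_1[OF prob_space_reward_law] by simp
  moreover have "reward_law a x = (if a = 1 then reward_law 1 x else reward_law 2 x)"
    by (simp add: reward_law_def par_def)
  ultimately show ?thesis by simp
qed

end

subsection \<open>Histories\<close>

definition stat :: "('a \<Rightarrow> real) \<Rightarrow> 'a list \<Rightarrow> real" where
  "stat f s = sum_list (map f s)"

lemma stat_add: "stat (\<lambda>z. f z + g z) s = stat f s + stat g s"
  by (simp add: stat_def sum_list_addf)

lemma stat_diff: "stat (\<lambda>z. f z - g z) s = stat f s - stat g s"
  by (simp add: stat_def sum_list_subtractf)

lemma stat_cmult: "stat (\<lambda>z. c * f z) s = c * stat f s"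
  by (simp add: stat_def sum_list_const_mult)

text \<open>The allocation rule reads the data only through additive statistics, so the \<open>\<sigma>\<close>-algebra
  generated by them suffices, and measurability of a function into it is checked on statistics.\<close>

definition stat_algebra :: "'a measure \<Rightarrow> 'a list measure" where
  "stat_algebra M = (SUP f \<in> borel_measurable M. vimage_algebra UNIV (stat f) borel)"

lemma measurable_stat_basic: "f \<in> borel_measurable M \<Longrightarrow> stat f \<in> borel_measurable (stat_algebra M)"
  unfolding stat_algebra_def by (rule measurable_SUP1) (auto intro: measurable_vimage_algebra1)

lemma measurable_stat [measurable (raw)]:
  "s \<in> N \<rightarrow>\<^sub>M stat_algebra M \<Longrightarrow> f \<in> borel_measurable M \<Longrightarrow> (\<lambda>w. stat f (s w)) \<in> borel_measurable N"
  using measurable_compose measurable_stat_basic by blast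

lemma measurable_stat_algebraI:
  assumes "\<And>f. f \<in> borel_measurable M \<Longrightarrow> (\<lambda>w. stat f (s w)) \<in> borel_measurable N"
  shows "s \<in> N \<rightarrow>\<^sub>M stat_algebra M"
  unfolding stat_algebra_def
proof (rule measurable_SUP2)
  show "borel_measurable M \<noteq> ({} :: ('a \<Rightarrow> real) set)" using borel_measurable_const by blast
qed (auto intro: measurable_vimage_algebra2 assms)

lemma measurable_length [measurable]: "length \<in> stat_algebra M \<rightarrow>\<^sub>M count_space UNIV"
proof -
  have length_eq: "length = (\<lambda>s :: 'a list. nat \<lfloor>stat (\<lambda>_. 1) s\<rfloor>)"
    by (simp add: fun_eq_iff stat_def sum_list_triv)
  show ?thesis
    unfolding length_eq using measurable_stat_basic[of "\<lambda>_. 1" M] by measurable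
qed

definition visits :: "'a set \<Rightarrow> 'a list \<Rightarrow> real" where
  "visits A = stat (indicator A)"

lemma measurable_visits [measurable (raw)]:
  "s \<in> N \<rightarrow>\<^sub>M stat_algebra M \<Longrightarrow> A \<in> sets M \<Longrightarrow> (\<lambda>w. visits A (s w)) \<in> borel_measurable N"
  unfolding visits_def by (intro measurable_stat borel_measurable_indicator)

subsection \<open>Adaptive sampling\<close>

type_synonym observation = "nat \<times> real \<times> real"
type_synonym allocation_rule = "observation list \<Rightarrow> real \<Rightarrow> nat"

text \<open>The recorded history omits the arms; they are recovered by replaying the rule.\<close>

definition annotate :: "allocation_rule \<Rightarrow> (real \<times> real) list \<Rightarrow> observation list" where
  "annotate D h = foldl (\<lambda>s (x, y). s @ [(D s x, x, y)]) [] h"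

definition policy :: "allocation_rule \<Rightarrow> (real \<times> real) list \<Rightarrow> real \<Rightarrow> nat" where
  "policy D h x = D (annotate D h) x"

definition obs :: "allocation_rule \<Rightarrow> (real \<times> real \<times> real) stream \<Rightarrow> nat \<Rightarrow> observation" where
  "obs D w t = (arm (policy D) w t, Xo w t, Yo (arm (policy D) w t) w t)"

definition past :: "allocation_rule \<Rightarrow> (real \<times> real \<times> real) stream \<Rightarrow> nat \<Rightarrow> observation list" where
  "past D w t = map (obs D w) [0..<t]"

lemma past_0: "past D w 0 = []"
  by (simp add: past_def)

lemma past_Suc: "past D w (Suc t) = past D w t @ [obs D w t]"
  by (simp add: past_def)

lemma length_past [simp]: "length (past D w t) = t"
  by (simp add: past_def)

lemma stat_past: "stat f (past D w t) = (\<Sum>u<t. f (obs D w u))"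
  by (induction t) (auto simp: stat_def past_0 past_Suc)

lemma stat_past_Suc: "stat f (past D w (Suc t)) = stat f (past D w t) + f (obs D w t)"
  by (simp add: stat_past)

lemma annotate_hist: "annotate D (hist (policy D) w t) = past D w t"
proof (induction t)
  case (Suc t)
  have "annotate D (h @ [(x, y)]) = annotate D h @ [(D (annotate D h) x, x, y)]" for h x y
    by (simp add: annotate_def)
  moreover have "arm (policy D) w t = D (annotate D (hist (policy D) w t)) (Xo w t)"
    unfolding arm_def policy_def by (rule refl)
  ultimately show ?case
    using Suc by (simp add: past_Suc obs_def arm_def[symmetric])
qed (simp add: annotate_def past_0)

lemma arm_policy: "arm (policy D) w t = D (past D w t) (Xo w t)"
  by (simp add: arm_def policy_def annotate_hist)

lemma hist_cong: "(\<And>u. u < t \<Longrightarrow> w !! u = w' !! u) \<Longrightarrow> hist pol w t = hist pol w' t"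
  by (induction t) (auto simp: Xo_def Yo_def)

lemma past_resample: "past D (resample w t s) t = past D w t"
  unfolding annotate_hist[symmetric] by (simp add: snth_resample cong: hist_cong)

lemma obs_resample:
  "obs D (resample w t (x, y1, y2)) t
    = (D (past D w t) x, x, if D (past D w t) x = 1 then y1 else y2)"
  by (simp add: obs_def arm_policy past_resample Xo_def Yo_def snth_resample)

subsection \<open>Measurability of adaptive sampling\<close>

abbreviation obs_space :: "observation measure" where
  "obs_space \<equiv> count_space UNIV \<Otimes>\<^sub>M borel \<Otimes>\<^sub>M borel"

abbreviation history_space :: "observation list measure" where
  "history_space \<equiv> stat_algebra obs_space"

lemma measurable_Xo [measurable]: "(\<lambda>w. Xo w t) \<in> borel_measurable (stream_space borel)"
proof -
  have "(\<lambda>w :: (real \<times> real \<times> real) stream. fst (w !! t))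
      \<in> stream_space (borel \<Otimes>\<^sub>M borel \<Otimes>\<^sub>M borel) \<rightarrow>\<^sub>M borel"
    by measurable
  then show ?thesis unfolding Xo_def borel_prod .
qed

lemma measurable_Yo [measurable]: "(\<lambda>w. Yo a w t) \<in> borel_measurable (stream_space borel)"
proof -
  have "(\<lambda>w :: (real \<times> real \<times> real) stream.
      if a = 1 then fst (snd (w !! t)) else snd (snd (w !! t)))
      \<in> stream_space (borel \<Otimes>\<^sub>M borel \<Otimes>\<^sub>M borel) \<rightarrow>\<^sub>M borel"
    by measurable
  then show ?thesis unfolding Yo_def borel_prod .
qed

context
  fixes D :: allocation_rule
  assumes D [measurable]: "(\<lambda>(s, x). D s x) \<in> history_space \<Otimes>\<^sub>M borel \<rightarrow>\<^sub>M count_space UNIV"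
begin

lemma measurable_arm_if_measurable_past:
  assumes [measurable]: "(\<lambda>w. past D w t) \<in> stream_space borel \<rightarrow>\<^sub>M history_space"
  shows "(\<lambda>w. arm (policy D) w t) \<in> stream_space borel \<rightarrow>\<^sub>M count_space UNIV"
  unfolding arm_policy by measurable

lemma measurable_obs_if_measurable_past:
  assumes "(\<lambda>w. past D w t) \<in> stream_space borel \<rightarrow>\<^sub>M history_space"
  shows "(\<lambda>w. obs D w t) \<in> stream_space borel \<rightarrow>\<^sub>M obs_space"
proof -
  note [measurable] = measurable_arm_if_measurable_past[OF assms]
  have "(\<lambda>w. Yo (arm (policy D) w t) w t) \<in> borel_measurable (stream_space borel)"
    by (rule measurable_compose_countable[where f = "\<lambda>a w. Yo a w t"]) measurable
  then show ?thesis unfolding obs_def by measurable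
qed

lemma measurable_past: "(\<lambda>w. past D w t) \<in> stream_space borel \<rightarrow>\<^sub>M history_space"
proof (induction t)
  case 0
  show ?case by (rule measurable_stat_algebraI) (simp add: stat_past)
next
  case (Suc t)
  note [measurable] = Suc measurable_obs_if_measurable_past[OF Suc]
  show ?case by (rule measurable_stat_algebraI) (simp add: stat_past_Suc)
qed

lemmas measurable_arm = measurable_arm_if_measurable_past[OF measurable_past]
lemmas measurable_obs = measurable_obs_if_measurable_past[OF measurable_past]

end

locale adaptive_sampling = bandit_env +
  fixes D :: allocation_rule
  assumes D_arms: "D s x \<in> {1, 2}"
    and measurable_D: "(\<lambda>(s, x). D s x) \<in> history_space \<Otimes>\<^sub>M borel \<rightarrow>\<^sub>M count_space UNIV"
begin

abbreviation "\<Omega> \<equiv> Omega F G C"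
abbreviation "past\<^sub>D \<equiv> past D"
abbreviation "obs\<^sub>D \<equiv> obs D"
abbreviation "arm\<^sub>D \<equiv> arm (policy D)"

lemmas measurable_past_D [measurable] = measurable_past[OF measurable_D]
lemmas measurable_obs_D [measurable] = measurable_obs[OF measurable_D]
lemmas measurable_arm_D [measurable] = measurable_arm[OF measurable_D]

lemma sets_Omega [measurable_cong]: "sets \<Omega> = sets (stream_space borel)"
  unfolding Omega_def by (rule sets_stream_space_cong[OF sets_step])

lemma space_Omega [simp]: "space \<Omega> = UNIV"
  using sets_eq_imp_space_eq[OF sets_Omega] by (simp add: space_stream_space)

sublocale Om: prob_space \<Omega>
  unfolding Omega_def by (rule prob_space.prob_space_stream_space[OF prob_space_step])

lemma measurable_resample_entry:
  assumes "g \<in> stream_space borel \<rightarrow>\<^sub>M N"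
  shows "(\<lambda>s. g (resample w t s)) \<in> borel \<rightarrow>\<^sub>M N"
  by (rule measurable_compose[OF measurable_resample assms]) (auto simp: space_stream_space)

lemma nn_integral_past_obs:
  fixes g :: "observation \<Rightarrow> ennreal"
  assumes [measurable]: "\<Phi> \<in> borel_measurable history_space" "g \<in> borel_measurable obs_space"
  shows "(\<integral>\<^sup>+w. \<Phi> (past\<^sub>D w t) * g (obs\<^sub>D w t) \<partial>\<Omega>)
    = (\<integral>\<^sup>+w. \<Phi> (past\<^sub>D w t) *
        (\<integral>\<^sup>+x. \<integral>\<^sup>+y. g (D (past\<^sub>D w t) x, x, y) \<partial>reward_law (D (past\<^sub>D w t) x) x \<partial>G) \<partial>\<Omega>)"
proof -
  have inner: "(\<integral>\<^sup>+s. \<Phi> (past\<^sub>D (resample w t s) t) * g (obs\<^sub>D (resample w t s) t) \<partial>step F G C)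
      = \<Phi> (past\<^sub>D w t) *
        (\<integral>\<^sup>+x. \<integral>\<^sup>+y. g (D (past\<^sub>D w t) x, x, y) \<partial>reward_law (D (past\<^sub>D w t) x) x \<partial>G)" for w
  proof -
    have g_meas: "(\<lambda>s. g (obs\<^sub>D (resample w t s) t)) \<in> borel_measurable borel"
      by (rule measurable_resample_entry) measurable
    have "(\<integral>\<^sup>+s. g (obs\<^sub>D (resample w t s) t) \<partial>step F G C)
        = (\<integral>\<^sup>+x. \<integral>\<^sup>+y. g (D (past\<^sub>D w t) x, x, y) \<partial>reward_law (D (past\<^sub>D w t) x) x \<partial>G)"
      unfolding nn_integral_step[OF g_meas] obs_resample
      by (intro nn_integral_cong nn_integral_reward_law_arm) measurable
    then show ?thesis
      unfolding past_resample
      by (subst nn_integral_cmult) (simp_all add: g_meas measurable_cong_sets[OF sets_step refl])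
  qed
  have "(\<integral>\<^sup>+w. \<Phi> (past\<^sub>D w t) * g (obs\<^sub>D w t) \<partial>\<Omega>)
      = (\<integral>\<^sup>+w. \<integral>\<^sup>+s. \<Phi> (past\<^sub>D (resample w t s) t) * g (obs\<^sub>D (resample w t s) t) \<partial>step F G C \<partial>\<Omega>)"
    unfolding Omega_def
    by (rule prob_space.nn_integral_resample[OF prob_space_step])
      (simp add: measurable_cong_sets[OF sets_stream_space_cong[OF sets_step] refl])
  then show ?thesis unfolding inner .
qed

lemma nn_integral_past_obs_le:
  fixes g :: "observation \<Rightarrow> ennreal"
  assumes [measurable]: "\<Phi> \<in> borel_measurable history_space" "g \<in> borel_measurable obs_space"
    and bound: "\<And>a x. a \<in> {1, 2} \<Longrightarrow> x \<in> Xs \<Longrightarrow> (\<integral>\<^sup>+y. g (a, x, y) \<partial>F (par C a) x) \<le> 1"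
  shows "(\<integral>\<^sup>+w. \<Phi> (past\<^sub>D w t) * g (obs\<^sub>D w t) \<partial>\<Omega>) \<le> (\<integral>\<^sup>+w. \<Phi> (past\<^sub>D w t) \<partial>\<Omega>)"
proof -
  have "(\<integral>\<^sup>+x. \<integral>\<^sup>+y. g (D s x, x, y) \<partial>reward_law (D s x) x \<partial>G) \<le> 1" for s
  proof -
    have "(\<integral>\<^sup>+x. \<integral>\<^sup>+y. g (D s x, x, y) \<partial>reward_law (D s x) x \<partial>G) \<le> (\<integral>\<^sup>+x. 1 \<partial>G)"
      using bound D_arms set_pmf_G
      by (intro nn_integral_mono_AE) (auto simp: AE_measure_pmf_iff reward_law_def)
    then show ?thesis by simp
  qed
  then have "(\<integral>\<^sup>+w. \<Phi> (past\<^sub>D w t) *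
        (\<integral>\<^sup>+x. \<integral>\<^sup>+y. g (D (past\<^sub>D w t) x, x, y) \<partial>reward_law (D (past\<^sub>D w t) x) x \<partial>G) \<partial>\<Omega>)
      \<le> (\<integral>\<^sup>+w. \<Phi> (past\<^sub>D w t) * 1 \<partial>\<Omega>)"
    by (intro nn_integral_mono mult_left_mono) auto
  then show ?thesis by (simp add: nn_integral_past_obs)
qed

subsection \<open>Exponential supermartingales\<close>

text \<open>The surplus \<open>1 - E exp f\<close> of each round may be spent on a charge \<open>h\<close>, out of an initial
  capital of \<open>1\<close>.\<close>

lemma nn_integral_exp_stat_plus_charges_le_1:
  fixes h :: "observation \<Rightarrow> ennreal"
  assumes [measurable]: "f \<in> borel_measurable obs_space" "h \<in> borel_measurable obs_space"
    and bound: "\<And>a x. a \<in> {1, 2} \<Longrightarrow> x \<in> Xs \<Longrightarrow>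
      (\<integral>\<^sup>+y. ennreal (exp (f (a, x, y))) + h (a, x, y) \<partial>F (par C a) x) \<le> 1"
  shows "(\<integral>\<^sup>+w. ennreal (exp (stat f (past\<^sub>D w n))) \<partial>\<Omega>)
    + (\<Sum>t<n. \<integral>\<^sup>+w. ennreal (exp (stat f (past\<^sub>D w t))) * h (obs\<^sub>D w t) \<partial>\<Omega>) \<le> 1"
proof (induction n)
  case 0
  show ?case using Om.emeasure_space_1 by (simp add: stat_past)
next
  case (Suc n)
  let ?S = "\<lambda>n w. ennreal (exp (stat f (past\<^sub>D w n)))"
  have "(\<integral>\<^sup>+w. ?S (Suc n) w \<partial>\<Omega>) + (\<integral>\<^sup>+w. ?S n w * h (obs\<^sub>D w n) \<partial>\<Omega>)
      = (\<integral>\<^sup>+w. ?S n w * (ennreal (exp (f (obs\<^sub>D w n))) + h (obs\<^sub>D w n)) \<partial>\<Omega>)"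
    by (simp add: stat_past_Suc exp_add ennreal_mult distrib_left nn_integral_add)
  also have "\<dots> \<le> (\<integral>\<^sup>+w. ?S n w \<partial>\<Omega>)"
    by (rule nn_integral_past_obs_le[where g = "\<lambda>z. ennreal (exp (f z)) + h z"])
      (measurable, rule bound)
  finally have "(\<integral>\<^sup>+w. ?S (Suc n) w \<partial>\<Omega>) + (\<integral>\<^sup>+w. ?S n w * h (obs\<^sub>D w n) \<partial>\<Omega>)
      + (\<Sum>t<n. \<integral>\<^sup>+w. ?S t w * h (obs\<^sub>D w t) \<partial>\<Omega>) \<le> 1"
    using Suc by (blast intro: order_trans[OF add_right_mono])
  then show ?case by (simp only: sum.lessThan_Suc ac_simps)
qed

lemma nn_integral_exp_stat_le_1:
  assumes [measurable]: "f \<in> borel_measurable obs_space"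
    and "\<And>a x. a \<in> {1, 2} \<Longrightarrow> x \<in> Xs \<Longrightarrow> (\<integral>\<^sup>+y. ennreal (exp (f (a, x, y))) \<partial>F (par C a) x) \<le> 1"
  shows "(\<integral>\<^sup>+w. ennreal (exp (stat f (past\<^sub>D w n))) \<partial>\<Omega>) \<le> 1"
  using nn_integral_exp_stat_plus_charges_le_1[of f "\<lambda>_. 0" n] assms by simp

lemma summable_events_if_stat_ge:
  assumes [measurable]: "f \<in> borel_measurable obs_space" "\<And>t. Measurable.pred \<Omega> (E t)"
    and bound: "\<And>a x. a \<in> {1, 2} \<Longrightarrow> x \<in> Xs \<Longrightarrow> (\<integral>\<^sup>+y. ennreal (exp (f (a, x, y))) \<partial>F (par C a) x) \<le> 1"
    and summable_c: "summable (\<lambda>t. exp (- c t))"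
    and E_imp: "\<And>t w. E t w \<Longrightarrow> c t \<le> stat f (past\<^sub>D w t)"
  shows "Om.summable_events E"
proof -
  have "\<P>(w in \<Omega>. E t w) \<le> exp (- c t)" for t
  proof -
    have "ennreal (exp (c t) * \<P>(w in \<Omega>. E t w)) \<le> (\<integral>\<^sup>+w. ennreal (exp (stat f (past\<^sub>D w t))) \<partial>\<Omega>)"
      using E_imp by (intro Om.prob_le_nn_integral ennreal_leI) simp_all
    also have "\<dots> \<le> 1" by (rule nn_integral_exp_stat_le_1[OF assms(1) bound])
    finally show ?thesis by (simp add: exp_minus field_simps ennreal_le_1)
  qed
  then have "summable (\<lambda>t. \<P>(w in \<Omega>. E t w))"
    by (intro summable_comparison_test'[OF summable_c]) simp
  then show ?thesis by (simp add: Om.summable_events_def assms(2))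
qed

lemma nn_integral_exp_stat_charge_le:
  assumes [measurable]: "f \<in> borel_measurable obs_space" "S \<in> sets borel"
    and \<delta>: "0 < \<delta>" "\<delta> \<le> 1"
    and bound: "\<And>a x. a \<in> {1, 2} \<Longrightarrow> x \<in> Xs \<Longrightarrow>
      (\<integral>\<^sup>+y. ennreal (exp (f (a, x, y))) \<partial>F (par C a) x)
        \<le> ennreal (if a = j \<and> x \<in> S then 1 - \<delta> else 1)"
  shows "(\<Sum>t<n. \<integral>\<^sup>+w. ennreal (exp (stat f (past\<^sub>D w t)))
    * (ennreal \<delta> * indicator ({j} \<times> S \<times> UNIV) (obs\<^sub>D w t)) \<partial>\<Omega>) \<le> 1" (is "?total \<le> 1")
proof -
  let ?h = "\<lambda>z :: observation. ennreal \<delta> * indicator ({j} \<times> S \<times> UNIV) z"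
  have "(\<integral>\<^sup>+y. ennreal (exp (f (a, x, y))) + ?h (a, x, y) \<partial>F (par C a) x) \<le> 1"
    if a_arm: "a \<in> {1, 2}" and x_in: "x \<in> Xs" for a x
  proof -
    note [measurable_cong] = sets_F[OF x_in]
    have "(\<integral>\<^sup>+y. ennreal (exp (f (a, x, y))) + ?h (a, x, y) \<partial>F (par C a) x)
        = (\<integral>\<^sup>+y. ennreal (exp (f (a, x, y))) \<partial>F (par C a) x)
          + ennreal (if a = j \<and> x \<in> S then \<delta> else 0)"
      using prob_space.emeasure_space_1[OF prob_space_F[OF x_in]]
      by (subst nn_integral_add) (simp_all add: indicator_def)
    also have "\<dots> \<le> ennreal (if a = j \<and> x \<in> S then 1 - \<delta> else 1)
        + ennreal (if a = j \<and> x \<in> S then \<delta> else 0)"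
      by (intro add_right_mono bound a_arm x_in)
    also have "\<dots> = 1" using \<delta> by (simp flip: ennreal_plus)
    finally show ?thesis .
  qed
  then have "(\<integral>\<^sup>+w. ennreal (exp (stat f (past\<^sub>D w n))) \<partial>\<Omega>) + ?total \<le> 1"
    by (intro nn_integral_exp_stat_plus_charges_le_1) measurable
  moreover have "?total \<le> (\<integral>\<^sup>+w. ennreal (exp (stat f (past\<^sub>D w n))) \<partial>\<Omega>) + ?total"
    by (rule add_increasing) simp_all
  ultimately show ?thesis by (rule order_trans[rotated])
qed

lemma summable_events_if_charged:
  assumes [measurable]: "f \<in> borel_measurable obs_space" "S \<in> sets borel"
      "\<And>t. Measurable.pred \<Omega> (E t)"
    and \<delta>: "0 < \<delta>" "\<delta> \<le> 1"
    and bound: "\<And>a x. a \<in> {1, 2} \<Longrightarrow> x \<in> Xs \<Longrightarrow>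
      (\<integral>\<^sup>+y. ennreal (exp (f (a, x, y))) \<partial>F (par C a) x)
        \<le> ennreal (if a = j \<and> x \<in> S then 1 - \<delta> else 1)"
    and E_imp: "\<And>t w. E t w \<Longrightarrow> arm\<^sub>D w t = j \<and> Xo w t \<in> S \<and> 0 \<le> stat f (past\<^sub>D w t)"
  shows "Om.summable_events E"
proof -
  let ?charge = "\<lambda>t w. ennreal (exp (stat f (past\<^sub>D w t)))
    * (ennreal \<delta> * indicator ({j} \<times> S \<times> UNIV) (obs\<^sub>D w t))"
  have prob_le: "ennreal (\<delta> * \<P>(w in \<Omega>. E t w)) \<le> (\<integral>\<^sup>+w. ?charge t w \<partial>\<Omega>)" for t
  proof (rule Om.prob_le_nn_integral)
    fix w assume "E t w"
    from E_imp[OF this] have cell: "obs\<^sub>D w t \<in> {j} \<times> S \<times> UNIV"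
      and nonneg: "0 \<le> stat f (past\<^sub>D w t)"
      by (auto simp: obs_def)
    have "ennreal 1 \<le> ennreal (exp (stat f (past\<^sub>D w t)))" using nonneg by (intro ennreal_leI) simp
    from mult_right_mono[OF this, of "ennreal \<delta>"] show "ennreal \<delta> \<le> ?charge t w" using cell by simp
  qed (use \<delta> in simp_all)
  have "(\<Sum>t<n. \<P>(w in \<Omega>. E t w)) \<le> 1 / \<delta>" for n
  proof -
    have "ennreal (\<delta> * (\<Sum>t<n. \<P>(w in \<Omega>. E t w))) = (\<Sum>t<n. ennreal (\<delta> * \<P>(w in \<Omega>. E t w)))"
      using \<delta> by (simp add: sum_distrib_left sum_ennreal)
    also have "\<dots> \<le> (\<Sum>t<n. \<integral>\<^sup>+w. ?charge t w \<partial>\<Omega>)" by (intro sum_mono prob_le)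
    also have "\<dots> \<le> 1" by (rule nn_integral_exp_stat_charge_le[OF assms(1,2) \<delta> bound])
    finally show ?thesis using \<delta> by (simp add: field_simps ennreal_le_1)
  qed
  then have "summable (\<lambda>t. \<P>(w in \<Omega>. E t w))"
    by (intro summableI_nonneg_bounded) auto
  then show ?thesis by (simp add: Om.summable_events_def assms(3))
qed

subsection \<open>The context is independent of the past\<close>

lemma emeasure_past_context:
  assumes [measurable]: "Measurable.pred history_space P" "S \<in> sets borel"
  shows "emeasure \<Omega> {w. P (past\<^sub>D w t) \<and> Xo w t \<in> S}
    = emeasure \<Omega> {w. P (past\<^sub>D w t)} * emeasure G S"
proof -
  have events: "{w \<in> space \<Omega>. P (past\<^sub>D w t) \<and> Xo w t \<in> S} \<in> sets \<Omega>"
    "{w \<in> space \<Omega>. P (past\<^sub>D w t)} \<in> sets \<Omega>" by measurable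
  have "emeasure \<Omega> {w. P (past\<^sub>D w t) \<and> Xo w t \<in> S}
      = (\<integral>\<^sup>+w. indicator {w. P (past\<^sub>D w t) \<and> Xo w t \<in> S} w \<partial>\<Omega>)"
    using events(1) by simp
  also have "\<dots> = (\<integral>\<^sup>+w. indicator {s. P s} (past\<^sub>D w t) * indicator S (fst (snd (obs\<^sub>D w t))) \<partial>\<Omega>)"
    by (rule nn_integral_cong) (simp add: obs_def indicator_def)
  also have "\<dots> = (\<integral>\<^sup>+w. indicator {s. P s} (past\<^sub>D w t) * emeasure G S \<partial>\<Omega>)"
    by (subst nn_integral_past_obs[where g = "\<lambda>z. indicator S (fst (snd z))"]) 
      (simp_all add: prob_space.emeasure_space_1[OF prob_space_reward_law])
  also have "\<dots> = (\<integral>\<^sup>+w. emeasure G S * indicator {w. P (past\<^sub>D w t)} w \<partial>\<Omega>)"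
    by (rule nn_integral_cong) (simp add: indicator_def)
  also have "\<dots> = emeasure \<Omega> {w. P (past\<^sub>D w t)} * emeasure G S"
    using events(2) by (simp add: nn_integral_cmult_indicator mult.commute)
  finally show ?thesis .
qed

lemma summable_events_if_summable_in_context:
  assumes summable_E: "Om.summable_events E" and x_pos: "0 < pmf G x"
    and [measurable]: "\<And>t. Measurable.pred history_space (P t)"
    and covered: "\<And>t w. P t (past\<^sub>D w t) \<Longrightarrow> Xo w t = x \<Longrightarrow> E t w"
  shows "Om.summable_events (\<lambda>t w. P t (past\<^sub>D w t))"
proof -
  have "Om.summable_events (\<lambda>t w. P t (past\<^sub>D w t) \<and> Xo w t \<in> {x})"
    by (rule Om.summable_events_subset[OF summable_E]) (use covered in auto)
  moreover have "\<P>(w in \<Omega>. P t (past\<^sub>D w t) \<and> Xo w t \<in> {x})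
      = pmf G x * \<P>(w in \<Omega>. P t (past\<^sub>D w t))" for t
    using emeasure_past_context[of "P t" "{x}" t]
    by (simp add: Om.emeasure_eq_measure emeasure_pmf_single mult.commute flip: ennreal_mult)
  ultimately show ?thesis using x_pos by (simp add: Om.summable_events_def summable_cmult_iff)
qed

lemma AE_context: "AE w in \<Omega>. Xo w t \<in> Xs"
proof -
  note [measurable] = sets_Xs
  have "emeasure G (- Xs) = 0"
    using set_pmf_G by (auto simp: measure_pmf.emeasure_eq_measure measure_pmf_zero_iff)
  then have "emeasure \<Omega> {w \<in> space \<Omega>. Xo w t \<notin> Xs} = 0"
    using emeasure_past_context[of "\<lambda>_. True" "- Xs" t] by simp
  moreover have "{w \<in> space \<Omega>. Xo w t \<notin> Xs} \<in> sets \<Omega>" by measurable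
  ultimately show ?thesis by (subst AE_iff_measurable[OF _ refl])
qed

lemma sum_prob_early_visits_le:
  assumes [measurable]: "A \<in> sets obs_space" and mono: "mono m" and nonneg: "0 \<le> m n"
  shows "(\<Sum>t<n. \<P>(w in \<Omega>. obs\<^sub>D w t \<in> A \<and> visits A (past\<^sub>D w t) < m t)) \<le> m n + 1"
proof (rule Om.sum_prob_le_count_bound)
  fix w
  have "(\<Sum>t<n. of_bool (obs\<^sub>D w t \<in> A \<and> visits A (past\<^sub>D w t) < m t) :: real)
      \<le> (\<Sum>t<n. of_bool (obs\<^sub>D w t \<in> A \<and> (\<Sum>u<t. of_bool (obs\<^sub>D w u \<in> A)) < m n))"
    using monoD[OF mono]
    by (intro sum_mono)
      (auto simp: visits_def stat_past indicator_def of_bool_def intro: less_le_trans)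
  also have "\<dots> \<le> m n + 1"
    by (rule sum_of_bool_count_less_le[OF nonneg])
  finally show "(\<Sum>t<n. of_bool (obs\<^sub>D w t \<in> A \<and> visits A (past\<^sub>D w t) < m t)) \<le> m n + 1" .
qed measurable

end

subsection \<open>The parametric family\<close>

locale bandit_family =
  fixes Th Xs :: "real set" and F :: "real \<Rightarrow> real \<Rightarrow> real measure" and G :: "real pmf"
  assumes finite_Th: "finite Th" and Th_nonempty: "Th \<noteq> {}"
    and finite_contexts: "finite Xs"
    and prob_space_kernel: "th \<in> Th \<Longrightarrow> x \<in> Xs \<Longrightarrow> prob_space (F th x)"
    and sets_kernel: "th \<in> Th \<Longrightarrow> x \<in> Xs \<Longrightarrow> sets (F th x) = sets borel"
    and set_pmf_subset: "set_pmf G \<subseteq> Xs" and pmf_pos: "x \<in> Xs \<Longrightarrow> 0 < pmf G x"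
    and KL_pos: "th \<in> Th \<Longrightarrow> v \<in> Th \<Longrightarrow> th \<noteq> v \<Longrightarrow> x \<in> Xs \<Longrightarrow> 0 < KLI F th v x"
    and KL_fin: "th \<in> Th \<Longrightarrow> v \<in> Th \<Longrightarrow> th \<noteq> v \<Longrightarrow> x \<in> Xs \<Longrightarrow> KLI F th v x < \<infinity>"
begin

lemma Xs_nonempty: "Xs \<noteq> {}"
  using set_pmf_subset set_pmf_not_empty[of G] by blast

definition ref :: real where
  "ref = (SOME th. th \<in> Th)"

definition log_density :: "real \<Rightarrow> real \<Rightarrow> real \<Rightarrow> real" where
  "log_density th x = entropy_density (exp 1) (F ref x) (F th x)"

definition log_ratio :: "real \<Rightarrow> real \<Rightarrow> real \<Rightarrow> real \<Rightarrow> real" where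
  "log_ratio th v x y = log_density v x y - log_density th x y"

definition lr_mgf :: "real \<Rightarrow> real \<Rightarrow> real \<Rightarrow> real \<Rightarrow> ennreal" where
  "lr_mgf th v x r = (\<integral>\<^sup>+y. ennreal (exp (r * log_ratio th v x y)) \<partial>F th x)"

lemma ref_in: "ref \<in> Th"
  unfolding ref_def using Th_nonempty by (simp add: some_in_eq)

lemma measurable_log_density_ref: "log_density th x \<in> borel_measurable (F ref x)"
  by (simp add: log_density_def)

lemma measurable_log_density: "x \<in> Xs \<Longrightarrow> log_density th x \<in> borel_measurable borel"
  using measurable_log_density_ref[of th x]
  by (simp add: measurable_cong_sets[OF sets_kernel[OF ref_in] refl])

lemma measurable_log_ratio: "x \<in> Xs \<Longrightarrow> log_ratio th v x \<in> borel_measurable borel"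
  unfolding log_ratio_def by (intro borel_measurable_diff measurable_log_density)

lemma absolutely_continuous_kernel:
  assumes "th \<in> Th" "v \<in> Th" "x \<in> Xs"
  shows "absolutely_continuous (F th x) (F v x)"
proof (cases "th = v")
  case False
  then show ?thesis
    using KL_fin[of v th x] assms by (auto simp: KLI_def intro: KL_finiteD)
qed (simp add: absolutely_continuous_def)

lemma sigma_finite_kernel: "th \<in> Th \<Longrightarrow> x \<in> Xs \<Longrightarrow> sigma_finite_measure (F th x)"
  by (intro prob_space_imp_sigma_finite prob_space_kernel)

lemma kernel_eq_density:
  assumes "th \<in> Th" "x \<in> Xs"
  shows "F th x = density (F ref x) (\<lambda>y. ennreal (exp (log_density th x y)))"
  unfolding log_density_def using assms ref_in
  by (intro density_exp_entropy_density[symmetric] sigma_finite_kernel absolutely_continuous_kernel)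
    (simp_all add: sets_kernel)

lemma lr_mgf_1:
  assumes "th \<in> Th" "v \<in> Th" "x \<in> Xs"
  shows "lr_mgf th v x 1 = 1"
  unfolding lr_mgf_def log_ratio_def mult_1
  by (rule nn_integral_exp_log_density_diff[OF measurable_log_density_ref measurable_log_density_ref
        kernel_eq_density kernel_eq_density prob_space_kernel]) (use assms in auto)

lemma integral_log_ratio:
  assumes "th \<in> Th" "v \<in> Th" "th \<noteq> v" "x \<in> Xs"
  shows "integrable (F th x) (log_ratio th v x)"
    "KLI F th v x = ereal (- (\<integral>y. log_ratio th v x y \<partial>F th x))"
proof -
  note KL = KL_eq_integral_log_density_diff[OF measurable_log_density_ref measurable_log_density_ref
      kernel_eq_density[OF assms(1,4)] kernel_eq_density[OF assms(2,4)]
      sigma_finite_kernel[OF assms(2,4)] KL_fin[OF assms, unfolded KLI_def]]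
  have log_ratio_eq: "log_ratio th v x = (\<lambda>y. - (log_density th x y - log_density v x y))"
    by (simp add: log_ratio_def fun_eq_iff)
  show "integrable (F th x) (log_ratio th v x)"
    unfolding log_ratio_eq by (rule integrable_minus[OF KL(1)])
  show "KLI F th v x = ereal (- (\<integral>y. log_ratio th v x y \<partial>F th x))"
    unfolding log_ratio_eq KLI_def KL(2) by (simp only: integral_minus minus_minus)
qed

lemma eventually_lr_mgf_le:
  assumes "th \<in> Th" "v \<in> Th" "th \<noteq> v" "x \<in> Xs" and k_less: "ereal k < KLI F th v x"
  shows "\<forall>\<^sub>F r in at_right 0. lr_mgf th v x r \<le> ennreal (exp (- (r * k)))"
  unfolding lr_mgf_def
proof (rule prob_space.eventually_nn_integral_exp_le[OF prob_space_kernel])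
  show "integrable (F th x) (log_ratio th v x)" by (rule integral_log_ratio[OF assms(1-4)])
  then show "integrable (F th x) (\<lambda>y. exp (log_ratio th v x y))"
    using lr_mgf_1[of th v x] assms by (intro integrableI_bounded) (auto simp: lr_mgf_def)
  show "k < - (\<integral>y. log_ratio th v x y \<partial>F th x)"
    using k_less by (simp add: integral_log_ratio[OF assms(1-4)])
qed (use assms in auto)

text \<open>A single exponent serves all contexts, since the log-likelihood pools observations
  from different contexts.\<close>

lemma lr_mgf_common_exponentE:
  assumes th_v: "th \<in> Th" "v \<in> Th" "th \<noteq> v" and k_less: "\<And>x. x \<in> Xs \<Longrightarrow> ereal (k x) < KLI F th v x"
  obtains r where "0 < r" "\<And>x. x \<in> Xs \<Longrightarrow> lr_mgf th v x r \<le> ennreal (exp (- (r * k x)))"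
proof -
  have "\<forall>\<^sub>F r in at_right 0. \<forall>x\<in>Xs. lr_mgf th v x r \<le> ennreal (exp (- (r * k x)))"
    using th_v k_less
    by (intro eventually_ball_finite finite_contexts ballI eventually_lr_mgf_le) auto
  moreover have "\<forall>\<^sub>F r in at_right 0. 0 < (r :: real)" by (rule eventually_at_right_less)
  ultimately have "\<forall>\<^sub>F r in at_right 0.
      0 < r \<and> (\<forall>x\<in>Xs. lr_mgf th v x r \<le> ennreal (exp (- (r * k x))))"
    by eventually_elim simp
  then show ?thesis
    using eventually_happens'[OF trivial_limit_at_right_real] that by blast
qed

lemma lr_mgf_uniform_decayE:
  assumes th_v: "th \<in> Th" "v \<in> Th" "th \<noteq> v"
  obtains r c where "0 < r" "0 < c" "\<And>x. x \<in> Xs \<Longrightarrow> lr_mgf th v x r \<le> ennreal (exp (- c))"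
proof -
  let ?K = "\<lambda>x. KLI F th v x"
  have "0 < Min (?K ` Xs)"
    using finite_contexts Xs_nonempty KL_pos[OF th_v] by (subst Min_gr_iff) auto
  then obtain k where k_between: "0 < ereal k" "ereal k < Min (?K ` Xs)"
    using ereal_dense2 by blast
  have "ereal k < ?K x" if "x \<in> Xs" for x
    by (rule less_le_trans[OF k_between(2) Min_le]) (use that finite_contexts in auto)
  then obtain r where "0 < r" "\<And>x. x \<in> Xs \<Longrightarrow> lr_mgf th v x r \<le> ennreal (exp (- (r * k)))"
    using lr_mgf_common_exponentE[OF th_v, of "\<lambda>_. k"] by blast
  then show ?thesis using k_between(1) by (intro that[of r "r * k"]) auto
qed

subsection \<open>The allocation rule\<close>

definition score :: "nat \<Rightarrow> real \<Rightarrow> observation \<Rightarrow> real" where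
  "score j th = (\<lambda>(a, x, y). if a = j \<and> x \<in> Xs then log_density th x y else 0)"

definition log_lik :: "nat \<Rightarrow> real \<Rightarrow> observation list \<Rightarrow> real" where
  "log_lik j th = stat (score j th)"

definition rejected :: "nat \<Rightarrow> real \<Rightarrow> real \<Rightarrow> observation list \<Rightarrow> bool" where
  "rejected j th v s \<longleftrightarrow> ln (threshold (length s)) \<le> log_lik j v s - log_lik j th s"

definition mle :: "nat \<Rightarrow> observation list \<Rightarrow> real" where
  "mle j s = arg_max_on (\<lambda>th. log_lik j th s) Th"

definition estimate :: "observation list \<Rightarrow> real \<times> real" where
  "estimate s = (mle 1 s, mle 2 s)"

definition better :: "real \<Rightarrow> real set" where
  "better g = {th \<in> Th. \<exists>x0 \<in> Xs. mu F th x0 > mu F g x0}"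

definition separating_context :: "real \<Rightarrow> real \<Rightarrow> real" where
  "separating_context b g = arg_max_on (\<lambda>x. INF th \<in> better g. KLI F b th x) Xs"

definition exploratory :: "nat \<Rightarrow> real \<times> real \<Rightarrow> observation list \<Rightarrow> real \<Rightarrow> bool" where
  "exploratory j C s x \<longleftrightarrow> \<not> revealing F Xs C \<and> x = separating_context (par C j) (par C (3 - j)) \<and>
     (\<exists>v \<in> better (par C (3 - j)). \<not> rejected j v (par C j) s)"

definition acceptable :: "nat \<Rightarrow> observation list \<Rightarrow> real \<Rightarrow> bool" where
  "acceptable j s x \<longleftrightarrow> j \<in> pref F (estimate s) x \<or> exploratory j (estimate s) s x"

definition pulls :: "nat \<Rightarrow> observation list \<Rightarrow> real" where
  "pulls j = visits ({j} \<times> UNIV \<times> UNIV)"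

definition allocate :: "observation list \<Rightarrow> real \<Rightarrow> nat" where
  "allocate s x =
    (if x \<in> Xs \<and> acceptable 1 s x \<and> (acceptable 2 s x \<longrightarrow> pulls 1 s \<le> pulls 2 s) then 1 else 2)"

lemma mle_in: "mle j s \<in> Th"
  unfolding mle_def by (rule arg_max_on_in[OF finite_Th Th_nonempty])

lemma log_lik_le_mle: "th \<in> Th \<Longrightarrow> log_lik j th s \<le> log_lik j (mle j s) s"
  unfolding mle_def by (rule arg_max_on_greatest[OF finite_Th Th_nonempty])

lemma par_estimate: "j \<in> {1, 2} \<Longrightarrow> par (estimate s) j = mle j s"
  by (auto simp: estimate_def par_def)

lemma better_subset: "better g \<subseteq> Th"
  by (auto simp: better_def)

lemma finite_better: "finite (better g)"
  using better_subset finite_Th by (rule finite_subset)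

lemma separating_context_in: "separating_context b g \<in> Xs"
  unfolding separating_context_def by (rule arg_max_on_in[OF finite_contexts Xs_nonempty])

lemma allocate_arms: "allocate s x \<in> {1, 2}"
  by (simp add: allocate_def)

lemma allocate_outside: "x \<notin> Xs \<Longrightarrow> allocate s x = 2"
  by (simp add: allocate_def)

lemma acceptable_allocate: "x \<in> Xs \<Longrightarrow> acceptable (allocate s x) s x"
proof -
  have "1 \<in> pref F (estimate s) x \<or> 2 \<in> pref F (estimate s) x" by (auto simp: pref_def)
  then have "acceptable 1 s x \<or> acceptable 2 s x" unfolding acceptable_def by blast
  then show "x \<in> Xs \<Longrightarrow> acceptable (allocate s x) s x" by (auto simp: allocate_def)
qed

lemma allocate_undersampled:
  assumes "x \<in> Xs" "j \<in> {1, 2}" "acceptable j s x" "pulls j s < pulls (3 - j) s"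
  shows "allocate s x = j"
proof -
  have "j = 1 \<and> 3 - j = 2 \<or> j = 2 \<and> 3 - j = 1" using assms(2) by auto
  then show ?thesis using assms by (auto simp: allocate_def)
qed

text \<open>An undersampled arm that is refused in every context is inferior everywhere for the estimated
  configuration, which is therefore not revealing; so the arm would be explored in the separating
  context unless all parameters that make it optimal somewhere had been rejected.\<close>

lemma undersampled_refused_imp_rejected:
  assumes j_arm: "j \<in> {1, 2}" and undersampled: "pulls j s < pulls (3 - j) s"
    and refused: "\<And>x. x \<in> Xs \<Longrightarrow> allocate s x \<noteq> j" and v_better: "v \<in> better (mle (3 - j) s)"
  shows "rejected j v (mle j s) s"
proof (rule ccontr)
  assume not_rejected: "\<not> ?thesis"
  have unacceptable: "\<not> acceptable j s x" if "x \<in> Xs" for x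
    using allocate_undersampled[OF that j_arm _ undersampled] refused[OF that] by blast
  then have "j \<notin> pref F (estimate s) x" if "x \<in> Xs" for x
    using that by (auto simp: acceptable_def)
  then have "\<not> revealing F Xs (estimate s)"
    using j_arm by (auto simp: revealing_def)
  moreover have "par (estimate s) j = mle j s" "par (estimate s) (3 - j) = mle (3 - j) s"
    using j_arm by (auto intro: par_estimate)
  ultimately have "exploratory j (estimate s) s (separating_context (mle j s) (mle (3 - j) s))"
    using v_better not_rejected by (auto simp: exploratory_def)
  then show False
    using unacceptable[OF separating_context_in] by (auto simp: acceptable_def)
qed

subsection \<open>Measurability of the allocation rule\<close>

lemma measurable_score: "score j th \<in> borel_measurable obs_space"
proof -
  have "score j th = (\<lambda>z. \<Sum>x\<in>Xs.
      if fst z = j \<and> fst (snd z) = x then log_density th x (snd (snd z)) else 0)"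
    using finite_contexts by (auto simp: score_def fun_eq_iff sum.delta intro!: sum.neutral)
  also have "\<dots> \<in> borel_measurable obs_space"
  proof (rule borel_measurable_sum)
    fix x assume "x \<in> Xs"
    note [measurable] = measurable_log_density[OF this, of th]
    show "(\<lambda>z. if fst z = j \<and> fst (snd z) = x then log_density th x (snd (snd z)) else 0)
        \<in> borel_measurable obs_space"
      by measurable
  qed
  finally show ?thesis .
qed

lemma measurable_log_lik [measurable]: "log_lik j th \<in> borel_measurable history_space"
  unfolding log_lik_def by (rule measurable_stat_basic[OF measurable_score])

lemma measurable_rejected [measurable]: "Measurable.pred history_space (rejected j th v)"
  unfolding rejected_def by measurable

lemma measurable_pulls [measurable]: "pulls j \<in> borel_measurable history_space"
  unfolding pulls_def by measurable

lemma measurable_mle [measurable]: "mle j \<in> history_space \<rightarrow>\<^sub>M count_space UNIV"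
  unfolding mle_def by (rule measurable_arg_max_on[OF finite_Th measurable_log_lik])

lemma measurable_estimate: "estimate \<in> history_space \<rightarrow>\<^sub>M count_space (Th \<times> Th)"
  unfolding measurable_count_space_eq2[OF finite_cartesian_product[OF finite_Th finite_Th]]
proof (intro conjI ballI)
  show "estimate \<in> space history_space \<rightarrow> Th \<times> Th" by (auto simp: estimate_def mle_in)
  show "estimate -` {C} \<inter> space history_space \<in> sets history_space" for C
  proof -
    have "{s \<in> space history_space. mle 1 s = fst C \<and> mle 2 s = snd C} \<in> sets history_space"
      by measurable
    moreover have "estimate -` {C} \<inter> space history_space
        = {s \<in> space history_space. mle 1 s = fst C \<and> mle 2 s = snd C}"
      by (auto simp: estimate_def prod_eq_iff)
    ultimately show ?thesis by simp
  qed
qed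

lemma measurable_acceptable [measurable]: "Measurable.pred history_space (\<lambda>s. acceptable j s x)"
  unfolding acceptable_def
proof (rule measurable_compose_countable'[OF _ measurable_estimate])
  fix C
  have [measurable]:
    "Measurable.pred history_space (\<lambda>s. \<exists>v\<in>better g. \<not> rejected j v th s)" for g th
    by (rule pred_intros_finite[OF finite_better]) measurable
  show "Measurable.pred history_space (\<lambda>s. j \<in> pref F C x \<or> exploratory j C s x)"
    unfolding exploratory_def by measurable
qed (use finite_Th in \<open>auto intro: countable_finite\<close>)

lemma measurable_allocate:
  "(\<lambda>(s, x). allocate s x) \<in> history_space \<Otimes>\<^sub>M borel \<rightarrow>\<^sub>M count_space UNIV"
proof -
  let ?first = "\<lambda>z. \<exists>x\<in>Xs. snd z = x \<and> acceptable 1 (fst z) x \<and>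
    (acceptable 2 (fst z) x \<longrightarrow> pulls 1 (fst z) \<le> pulls 2 (fst z))"
  have [measurable]: "Measurable.pred (history_space \<Otimes>\<^sub>M borel) ?first"
    by (rule pred_intros_finite[OF finite_contexts]) measurable
  have "(\<lambda>z. if ?first z then 1 else 2 :: nat) \<in> history_space \<Otimes>\<^sub>M borel \<rightarrow>\<^sub>M count_space UNIV"
    by measurable
  moreover have "(\<lambda>(s, x). allocate s x) = (\<lambda>z. if ?first z then 1 else 2)"
    by (auto simp: allocate_def fun_eq_iff)
  ultimately show ?thesis by simp
qed

lemma measurable_allocate_context [measurable]:
  "(\<lambda>s. allocate s x) \<in> history_space \<rightarrow>\<^sub>M count_space UNIV"
  using measurable_compose[OF measurable_Pair2' measurable_allocate, of x] by simp

end

subsection \<open>Estimation errors\<close>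

locale bandit_problem = bandit_family +
  fixes C :: "real \<times> real"
  assumes C_in: "fst C \<in> Th" "snd C \<in> Th"
begin

lemma par_in: "par C j \<in> Th"
  using C_in by (simp add: par_def)

sublocale adaptive_sampling Xs F G C allocate
proof (intro adaptive_sampling.intro bandit_env.intro adaptive_sampling_axioms.intro)
  show "prob_space (F (par C a) x)" "sets (F (par C a) x) = sets borel" if "x \<in> Xs" for a x
    by (intro prob_space_kernel sets_kernel par_in that)+
qed (rule set_pmf_subset finite_contexts allocate_arms measurable_allocate)+

definition gain :: "nat \<Rightarrow> real \<Rightarrow> observation \<Rightarrow> real" where
  "gain j v = (\<lambda>z. score j v z - score j (par C j) z)"

definition misfit :: "nat \<Rightarrow> real \<Rightarrow> observation list \<Rightarrow> bool" where
  "misfit j v s \<longleftrightarrow> log_lik j (par C j) s \<le> log_lik j v s"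

definition misestimated :: "nat \<Rightarrow> observation list \<Rightarrow> bool" where
  "misestimated j s \<longleftrightarrow> mle j s \<noteq> par C j"

lemma measurable_gain [measurable]: "gain j v \<in> borel_measurable obs_space"
  unfolding gain_def by (intro borel_measurable_diff measurable_score)

lemma measurable_misfit [measurable]: "Measurable.pred history_space (misfit j v)"
  unfolding misfit_def by measurable

lemma measurable_misestimated [measurable]: "Measurable.pred history_space (misestimated j)"
  unfolding misestimated_def by measurable

lemma stat_gain: "stat (gain j v) s = log_lik j v s - log_lik j (par C j) s"
  by (simp add: gain_def log_lik_def stat_diff)

lemma misestimated_imp_misfit: "misestimated j s \<Longrightarrow> \<exists>v\<in>Th - {par C j}. misfit j v s"
  using mle_in log_lik_le_mle[OF par_in] unfolding misestimated_def misfit_def by blast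

lemma nn_integral_exp_gain:
  assumes x_in: "x \<in> Xs"
  shows "(\<integral>\<^sup>+y. ennreal (exp (r * gain j v (a, x, y) + b)) \<partial>F (par C a) x)
    = ennreal (exp b) * (if a = j then lr_mgf (par C j) v x r else 1)"
proof -
  note [measurable] = measurable_log_ratio[OF x_in, of "par C j" v]
  note [measurable_cong] = sets_F[OF x_in]
  show ?thesis
    using prob_space.emeasure_space_1[OF prob_space_F[OF x_in]] x_in
    by (simp add: gain_def score_def log_ratio_def[symmetric] lr_mgf_def exp_add ennreal_mult
        mult.commute nn_integral_cmult)
qed

lemma summable_misfit_pulls:
  assumes v_false: "v \<in> Th" "v \<noteq> par C j"
  shows "Om.summable_events (\<lambda>t w. arm\<^sub>D w t = j \<and> misfit j v (past\<^sub>D w t))"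
proof -
  obtain r c where r_pos: "0 < r" and c_pos: "0 < c"
    and decay: "\<And>x. x \<in> Xs \<Longrightarrow> lr_mgf (par C j) v x r \<le> ennreal (exp (- c))"
    using lr_mgf_uniform_decayE[OF par_in v_false(1) v_false(2)[symmetric]] by blast
  show ?thesis
  proof (rule summable_events_if_charged[where f = "\<lambda>z. r * gain j v z" and j = j and S = UNIV
        and \<delta> = "1 - exp (- c)"])
    show "(\<integral>\<^sup>+y. ennreal (exp (r * gain j v (a, x, y))) \<partial>F (par C a) x)
        \<le> ennreal (if a = j \<and> x \<in> UNIV then 1 - (1 - exp (- c)) else 1)" if "x \<in> Xs" for a x
      using nn_integral_exp_gain[OF that, of a r j v 0] decay[OF that] by simp
    show "arm\<^sub>D w t = j \<and> Xo w t \<in> UNIV \<and> 0 \<le> stat (\<lambda>z. r * gain j v z) (past\<^sub>D w t)"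
      if "arm\<^sub>D w t = j \<and> misfit j v (past\<^sub>D w t)" for t w
      using that r_pos by (simp add: stat_cmult stat_gain misfit_def)
  qed (use c_pos in auto)
qed

lemma summable_misfit_oversampled:
  assumes v_false: "v \<in> Th" "v \<noteq> par C j"
  shows "Om.summable_events
    (\<lambda>t w. real t \<le> 2 * pulls j (past\<^sub>D w t) \<and> misfit j v (past\<^sub>D w t))"
proof -
  obtain r c where r_pos: "0 < r" and c_pos: "0 < c"
    and decay: "\<And>x. x \<in> Xs \<Longrightarrow> lr_mgf (par C j) v x r \<le> ennreal (exp (- c))"
    using lr_mgf_uniform_decayE[OF par_in v_false(1) v_false(2)[symmetric]] by blast
  let ?pull = "indicator ({j} \<times> UNIV \<times> UNIV) :: observation \<Rightarrow> real"
  show ?thesis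
  proof (rule summable_events_if_stat_ge[where f = "\<lambda>z. r * gain j v z + c * ?pull z"
        and c = "\<lambda>t. c * real t / 2"])
    show "(\<integral>\<^sup>+y. ennreal (exp (r * gain j v (a, x, y) + c * ?pull (a, x, y))) \<partial>F (par C a) x) \<le> 1"
      if x_in: "x \<in> Xs" for a x
    proof (cases "a = j")
      case True
      have "ennreal (exp c) * lr_mgf (par C j) v x r \<le> ennreal (exp c) * ennreal (exp (- c))"
        by (intro mult_left_mono decay x_in) simp
      then show ?thesis
        using True nn_integral_exp_gain[OF x_in, of a r j v c]
        by (simp add: exp_minus flip: ennreal_mult)
    qed (use nn_integral_exp_gain[OF x_in, of a r j v 0] in simp)
    have "summable (\<lambda>t. exp (- (c / 2)) ^ t)" using c_pos by (intro summable_geometric) simp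
    then show "summable (\<lambda>t. exp (- (c * real t / 2)))"
      by (simp add: exp_of_nat_mult[symmetric] mult.commute)
    fix t w
    assume event: "real t \<le> 2 * pulls j (past\<^sub>D w t) \<and> misfit j v (past\<^sub>D w t)"
    have "c * (real t / 2) \<le> c * pulls j (past\<^sub>D w t)"
      using event c_pos by (intro mult_left_mono) auto
    moreover have "0 \<le> r * stat (gain j v) (past\<^sub>D w t)"
      using event r_pos by (simp add: stat_gain misfit_def)
    ultimately show "c * real t / 2 \<le> stat (\<lambda>z. r * gain j v z + c * ?pull z) (past\<^sub>D w t)"
      by (simp add: stat_add stat_cmult pulls_def visits_def)
  qed measurable
qed

lemma summable_false_rejections:
  assumes v_in: "v \<in> Th"
  shows "Om.summable_events (\<lambda>t w. rejected j (par C j) v (past\<^sub>D w t))"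
proof (rule summable_events_if_stat_ge[where f = "gain j v" and c = "\<lambda>t. ln (threshold t)"])
  show "(\<integral>\<^sup>+y. ennreal (exp (gain j v (a, x, y))) \<partial>F (par C a) x) \<le> 1" if "x \<in> Xs" for a x
    using nn_integral_exp_gain[OF that, of a 1 j v 0] lr_mgf_1[OF par_in v_in that, of j] by simp
  have "exp (- ln (threshold t)) = 1 / threshold t" for t
    using threshold_ge_1[of t] by (simp add: exp_minus inverse_eq_divide)
  then show "summable (\<lambda>t. exp (- ln (threshold t)))" by (simp add: summable_inverse_threshold)
qed (simp_all add: stat_gain rejected_def)

lemma summable_events_misestimated:
  assumes [measurable]: "\<And>t. Measurable.pred \<Omega> (P t)"
    and misfit: "\<And>v. v \<in> Th \<Longrightarrow> v \<noteq> par C j \<Longrightarrow>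
      Om.summable_events (\<lambda>t w. P t w \<and> misfit j v (past\<^sub>D w t))"
  shows "Om.summable_events (\<lambda>t w. P t w \<and> misestimated j (past\<^sub>D w t))"
proof (rule Om.summable_events_subset)
  show "Om.summable_events (\<lambda>t w. \<exists>v\<in>Th - {par C j}. P t w \<and> misfit j v (past\<^sub>D w t))"
    by (rule Om.summable_events_Bex) (use finite_Th misfit in auto)
qed (use misestimated_imp_misfit in \<open>measurable, blast\<close>)

lemma summable_misestimated_pulls:
  "Om.summable_events (\<lambda>t w. arm\<^sub>D w t = j \<and> misestimated j (past\<^sub>D w t))"
  by (rule summable_events_misestimated) (measurable, rule summable_misfit_pulls)

lemma summable_misestimated_oversampled:
  "Om.summable_events (\<lambda>t w. real t \<le> 2 * pulls j (past\<^sub>D w t) \<and> misestimated j (past\<^sub>D w t))"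
  by (rule summable_events_misestimated) (measurable, rule summable_misfit_oversampled)

lemma summable_misestimated_allocate:
  assumes "x \<in> Xs"
  shows "Om.summable_events (\<lambda>t w. allocate (past\<^sub>D w t) x = j \<and> misestimated j (past\<^sub>D w t))"
proof (rule summable_events_if_summable_in_context[OF summable_misestimated_pulls[of j]
      pmf_pos[OF assms], where P = "\<lambda>t s. allocate s x = j \<and> misestimated j s"])
  show "Measurable.pred history_space (\<lambda>s. allocate s x = j \<and> misestimated j s)" by measurable
qed (auto simp: arm_policy)

definition mistake :: "nat \<Rightarrow> (real \<times> real \<times> real) stream \<Rightarrow> bool" where
  "mistake t w \<longleftrightarrow> (\<exists>j\<in>{1, 2}.
     (arm\<^sub>D w t = j \<and> misestimated j (past\<^sub>D w t)) \<or>
     (real t \<le> 2 * pulls j (past\<^sub>D w t) \<and> misestimated j (past\<^sub>D w t)) \<or>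
     (\<exists>x\<in>Xs. allocate (past\<^sub>D w t) x = j \<and> misestimated j (past\<^sub>D w t)) \<or>
     (\<exists>v\<in>Th. rejected j (par C j) v (past\<^sub>D w t)))"

lemma summable_mistake: "Om.summable_events mistake"
proof -
  have "Om.summable_events (\<lambda>t w. mistake t w)"
    unfolding mistake_def
    by (intro Om.summable_events_Bex Om.summable_events_disj summable_misestimated_pulls
        summable_misestimated_oversampled summable_misestimated_allocate summable_false_rejections)
      (use finite_Th finite_contexts in auto)
  then show ?thesis by simp
qed

lemma pulls_total: "pulls 1 (past\<^sub>D w t) + pulls 2 (past\<^sub>D w t) = real t"
proof (induction t)
  case (Suc t)
  have "arm\<^sub>D w t = 1 \<or> arm\<^sub>D w t = 2"
    using allocate_arms by (auto simp: arm_policy)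
  then show ?case
    using Suc by (auto simp: pulls_def visits_def stat_past obs_def indicator_def)
qed (simp add: pulls_def visits_def stat_past)

text \<open>The estimate of the pulled arm is correct. If that of the other arm \<open>j\<close> were wrong, then \<open>j\<close>
  would be undersampled and refused in every context, although its true parameter beats the pulled
  arm somewhere and has not been rejected.\<close>

lemma inferior_pull_exploratory:
  assumes context_in: "Xo w t \<in> Xs" and inferior: "arm\<^sub>D w t \<notin> pref F C (Xo w t)"
    and no_mistake: "\<not> mistake t w"
  shows "exploratory (arm\<^sub>D w t) C (past\<^sub>D w t) (Xo w t)"
proof -
  define a where "a = arm\<^sub>D w t"
  define j where "j = 3 - a"
  define s where "s = past\<^sub>D w t"
  have a_arm: "a \<in> {1, 2}" unfolding a_def arm_policy by (rule allocate_arms)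
  then have j_arm: "j \<in> {1, 2}" "3 - j = a" by (auto simp: j_def)
  have mle_a: "mle a s = par C a"
    using no_mistake a_arm unfolding mistake_def misestimated_def a_def s_def by blast
  have "par C j \<in> better (mle a s)"
    using inferior context_in par_in a_arm
    by (auto simp: mle_a better_def pref_def a_def[symmetric] j_def not_le)
  have mle_j: "mle j s = par C j"
  proof (rule ccontr)
    assume "mle j s \<noteq> par C j"
    then have "\<not> real t \<le> 2 * pulls j s" and refused: "\<And>x. x \<in> Xs \<Longrightarrow> allocate s x \<noteq> j"
      using no_mistake j_arm(1) unfolding mistake_def misestimated_def s_def by blast+
    moreover have "pulls j s + pulls a s = real t"
      using pulls_total[of w t] a_arm by (auto simp: s_def j_def)
    ultimately have "pulls j s < pulls (3 - j) s" using j_arm by simp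
    then have "rejected j (par C j) (mle j s) s"
      using undersampled_refused_imp_rejected[OF j_arm(1) _ refused, of "par C j"] j_arm(2)
        \<open>par C j \<in> better (mle a s)\<close> by simp
    then show False
      using no_mistake j_arm(1) mle_in unfolding mistake_def s_def by blast
  qed
  have "estimate s = C"
    using mle_a mle_j a_arm by (auto simp: estimate_def par_def j_def prod_eq_iff)
  then show ?thesis
    using acceptable_allocate[OF context_in, of s] inferior
    unfolding acceptable_def s_def arm_policy by simp
qed

subsection \<open>Exploration\<close>

definition early_exploration :: "real \<Rightarrow> nat \<Rightarrow> real \<Rightarrow> nat \<Rightarrow> (real \<times> real \<times> real) stream \<Rightarrow> bool" where
  "early_exploration k b x0 t w \<longleftrightarrow>
     obs\<^sub>D w t \<in> {b} \<times> {x0} \<times> UNIV \<and> visits ({b} \<times> {x0} \<times> UNIV) (past\<^sub>D w t) < ln (threshold t) / k"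

definition late_exploration ::
    "real \<Rightarrow> nat \<Rightarrow> real \<Rightarrow> real \<Rightarrow> nat \<Rightarrow> (real \<times> real \<times> real) stream \<Rightarrow> bool" where
  "late_exploration k b x0 v t w \<longleftrightarrow> obs\<^sub>D w t \<in> {b} \<times> {x0} \<times> UNIV \<and>
     \<not> rejected b v (par C b) (past\<^sub>D w t) \<and>
     ln (threshold t) \<le> k * visits ({b} \<times> {x0} \<times> UNIV) (past\<^sub>D w t)"

lemma measurable_early_exploration [measurable]:
  "Measurable.pred \<Omega> (early_exploration k b x0 t)"
  unfolding early_exploration_def by measurable

lemma measurable_late_exploration [measurable]:
  "Measurable.pred \<Omega> (late_exploration k b x0 v t)"
  unfolding late_exploration_def by measurable

lemma sum_prob_early_exploration_le:
  assumes k_pos: "0 < k"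
  shows "(\<Sum>t<T. \<P>(w in \<Omega>. early_exploration k b x0 t w)) \<le> ln (threshold T) / k + 1"
  unfolding early_exploration_def
proof (rule sum_prob_early_visits_le)
  show "mono (\<lambda>t. ln (threshold t) / k)"
    using k_pos by (intro monoI divide_right_mono ln_threshold_mono) auto
  show "0 \<le> ln (threshold T) / k" using k_pos threshold_ge_1 by simp
qed measurable

lemma summable_late_exploration:
  assumes v_false: "v \<in> Th" "v \<noteq> par C b" and x0_in: "x0 \<in> Xs"
    and k_less: "ereal k < KLI F (par C b) v x0"
  shows "Om.summable_events (late_exploration k b x0 v)"
proof -
  let ?visit = "indicator ({b} \<times> {x0} \<times> UNIV) :: observation \<Rightarrow> real"
  obtain k' where k'_between: "k < k'" "ereal k' < KLI F (par C b) v x0"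
    using ereal_dense2[OF k_less] by auto
  have "ereal (if x = x0 then k' else 0) < KLI F (par C b) v x" if "x \<in> Xs" for x
    using k'_between(2) KL_pos[OF par_in v_false(1) v_false(2)[symmetric] that]
    by (simp flip: zero_ereal_def)
  from lr_mgf_common_exponentE[OF par_in v_false(1) v_false(2)[symmetric] this]
  obtain r where r_pos: "0 < r" and mgf_le: "\<And>x. x \<in> Xs \<Longrightarrow>
      lr_mgf (par C b) v x r \<le> ennreal (exp (- (r * (if x = x0 then k' else 0))))"
    by blast
  let ?f = "\<lambda>z. r * gain b v z + (r * k) * ?visit z" and ?\<delta> = "1 - exp (r * (k - k'))"
  show ?thesis
  proof (rule summable_events_if_charged[where f = ?f and j = b and S = "{x0}" and \<delta> = ?\<delta>])
    show "0 < ?\<delta>" using r_pos k'_between(1) by (simp add: mult_pos_neg)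
    show "(\<integral>\<^sup>+y. ennreal (exp (?f (a, x, y))) \<partial>F (par C a) x)
        \<le> ennreal (if a = b \<and> x \<in> {x0} then 1 - ?\<delta> else 1)" if x_in: "x \<in> Xs" for a x
    proof (cases "a = b \<and> x = x0")
      case True
      have "ennreal (exp (r * k)) * lr_mgf (par C b) v x0 r
          \<le> ennreal (exp (r * k)) * ennreal (exp (- (r * k')))"
        using mgf_le[OF x0_in] by (intro mult_left_mono) simp_all
      also have "\<dots> = ennreal (exp (r * (k - k')))"
        by (simp add: right_diff_distrib exp_diff exp_minus field_simps flip: ennreal_mult)
      finally show ?thesis using True nn_integral_exp_gain[OF x_in, of a r b v "r * k"] by simp
    next
      case False
      then show ?thesis using nn_integral_exp_gain[OF x_in, of a r b v 0] mgf_le[OF x_in] by auto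
    qed
    have "stat ?f s = r * (log_lik b v s - log_lik b (par C b) s
        + k * visits ({b} \<times> {x0} \<times> UNIV) s)" for s
      by (simp add: stat_add stat_cmult stat_gain visits_def algebra_simps)
    then show "arm\<^sub>D w t = b \<and> Xo w t \<in> {x0} \<and> 0 \<le> stat ?f (past\<^sub>D w t)"
      if "late_exploration k b x0 v t w" for t w
      using that r_pos
      by (auto simp: late_exploration_def rejected_def obs_def intro!: mult_nonneg_nonneg)
  qed (simp_all add: late_exploration_def)
qed

subsection \<open>Regret\<close>

abbreviation inferior :: "nat \<Rightarrow> (real \<times> real \<times> real) stream \<Rightarrow> bool" where
  "inferior t w \<equiv> arm\<^sub>D w t \<notin> pref F C (Xo w t)"

abbreviation regret_count :: "nat \<Rightarrow> (real \<times> real \<times> real) stream \<Rightarrow> real" where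
  "regret_count T w \<equiv> real (Tinf F C (policy allocate) w T)"

abbreviation regret :: "nat \<Rightarrow> real" where
  "regret T \<equiv> ETinf F G C (policy allocate) T"

lemma regret_count_eq_sum: "regret_count T w = (\<Sum>t<T. of_bool (inferior t w))"
proof -
  have "{t. t < T \<and> inferior t w} = {t \<in> {..<T}. inferior t w}" by auto
  then show ?thesis
    unfolding Tinf_def by (simp add: sum.If_cases Int_def of_bool_def)
qed

lemma regret_count_le: "regret_count T w \<le> real T"
  unfolding Tinf_def by (rule of_nat_mono, rule order_trans[OF card_mono[of "{..<T}"]]) auto

lemma integrable_regret_count:
  "regret_count T \<in> borel_measurable \<Omega> \<Longrightarrow> integrable \<Omega> (regret_count T)"
  using regret_count_le by (intro Om.integrable_const_bound[where B = "real T"]) auto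

text \<open>The means, and hence the preferred arm, need not depend measurably on contexts outside
  \<open>Xs\<close>. If they do not, \<^const>\<open>Tinf\<close> is non-measurable at every positive time, and its Bochner
  integral has the junk value \<open>0\<close>. Streams with a constant context detect this.\<close>

lemma measurable_regret_count_all:
  assumes T_pos: "0 < T" and measurable_T: "regret_count T \<in> borel_measurable \<Omega>"
  shows "regret_count n \<in> borel_measurable \<Omega>"
proof -
  let ?bad = "{x. x \<notin> Xs \<and> 2 \<notin> pref F C x}"
  note [measurable] = sets_Xs
  have "(\<lambda>x :: real. sconst (x, 0 :: real, 0 :: real)) \<in> borel \<rightarrow>\<^sub>M stream_space borel"
    by (rule measurable_stream_space2) (simp add: borel_measurable_Pair)
  from measurable_compose[OF this, of "regret_count T"] measurable_T
  have [measurable]: "(\<lambda>x. regret_count T (sconst (x, 0, 0))) \<in> borel_measurable borel"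
    by (simp add: measurable_cong_sets[OF sets_Omega refl])
  have const: "regret_count T (sconst (x, 0, 0)) = (if 2 \<in> pref F C x then 0 else real T)"
    if "x \<notin> Xs" for x
    using that by (simp add: regret_count_eq_sum arm_policy Xo_def allocate_outside)
  have "?bad = {x \<in> space borel. x \<notin> Xs \<and> 0 < regret_count T (sconst (x, 0, 0))}"
    using const T_pos by (auto simp del: of_nat_0_less_iff)
  also have "\<dots> \<in> sets borel" by measurable
  finally have "?bad \<in> sets borel" .
  then have [measurable]: "Measurable.pred \<Omega> (\<lambda>w. Xo w t \<in> ?bad)" for t
    by (rule pred_sets2) measurable
  have [measurable]: "Measurable.pred \<Omega> (\<lambda>w. \<exists>x\<in>Xs. Xo w t = x \<and> arm\<^sub>D w t \<notin> pref F C x)" for t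
    by (rule pred_intros_finite(4)[OF finite_contexts]) measurable
  have inferior_iff: "inferior t w \<longleftrightarrow>
      (\<exists>x\<in>Xs. Xo w t = x \<and> arm\<^sub>D w t \<notin> pref F C x) \<or> Xo w t \<in> ?bad" for t w
    by (cases "Xo w t \<in> Xs") (auto simp: arm_policy allocate_outside)
  have [measurable]: "Measurable.pred \<Omega> (inferior t)" for t
    unfolding inferior_iff by (rule pred_intros_logic(5)) measurable
  show ?thesis unfolding regret_count_eq_sum of_bool_def by measurable
qed

lemma incseq_regret: "incseq regret"
proof (cases "\<forall>T. regret_count T \<in> borel_measurable \<Omega>")
  case True
  have "regret_count T w \<le> regret_count (Suc T) w" for T w
    unfolding regret_count_eq_sum by simp
  then show ?thesis unfolding ETinf_def
    using True by (intro incseq_SucI integral_mono integrable_regret_count) blast+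
next
  case False
  have "regret T = 0" for T
  proof (cases "T = 0")
    case False
    then have "\<not> integrable \<Omega> (regret_count T)"
      using measurable_regret_count_all \<open>\<not> (\<forall>T. _ T)\<close> by blast
    then show ?thesis unfolding ETinf_def by (rule not_integrable_integral_eq)
  qed (simp add: ETinf_def Tinf_def)
  then show ?thesis by (simp add: incseq_def)
qed

lemma regret_le_sum_prob:
  assumes [measurable]: "\<And>t. Measurable.pred \<Omega> (E t)"
    and cover: "\<And>t. AE w in \<Omega>. inferior t w \<longrightarrow> E t w"
  shows "regret T \<le> (\<Sum>t<T. \<P>(w in \<Omega>. E t w))"
proof (cases "integrable \<Omega> (regret_count T)")
  case True
  have "AE w in \<Omega>. \<forall>t\<in>{..<T}. inferior t w \<longrightarrow> E t w"
    by (rule AE_finite_allI) (auto intro: cover)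
  then have "AE w in \<Omega>. regret_count T w \<le> (\<Sum>t<T. of_bool (E t w))"
    unfolding regret_count_eq_sum by eventually_elim (rule sum_mono, simp)
  then have "regret T \<le> (\<integral>w. (\<Sum>t<T. of_bool (E t w)) \<partial>\<Omega>)"
    unfolding ETinf_def
    by (intro integral_mono_AE True Bochner_Integration.integrable_sum Om.integrable_of_bool assms)
  also have "\<dots> = (\<Sum>t<T. \<P>(w in \<Omega>. E t w))"
    by (rule Om.expectation_count) measurable
  finally show ?thesis .
next
  case False
  then have "regret T = 0" unfolding ETinf_def by (rule not_integrable_integral_eq)
  then show ?thesis by (simp add: sum_nonneg)
qed

lemma AE_inferior:
  "AE w in \<Omega>. inferior t w \<longrightarrow>
    mistake t w \<or> (Xo w t \<in> Xs \<and> exploratory (arm\<^sub>D w t) C (past\<^sub>D w t) (Xo w t))"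
  using AE_context[of t] by eventually_elim (use inferior_pull_exploratory in blast)

theorem regret_converges_if_revealing:
  assumes "revealing F Xs C"
  shows "\<exists>L. regret \<longlonglongrightarrow> L"
proof -
  have "AE w in \<Omega>. inferior t w \<longrightarrow> mistake t w" for t
    using AE_inferior[of t] by eventually_elim (use assms in \<open>auto simp: exploratory_def\<close>)
  then have "regret T \<le> (\<Sum>t<T. \<P>(w in \<Omega>. mistake t w))" for T
    using summable_mistake by (intro regret_le_sum_prob) (auto simp: Om.summable_events_def)
  also have "(\<Sum>t<T. \<P>(w in \<Omega>. mistake t w)) \<le> (\<Sum>t. \<P>(w in \<Omega>. mistake t w))" for T
    using summable_mistake by (intro sum_le_suminf) (auto simp: Om.summable_events_def)
  finally have "\<forall>T. regret T \<le> (\<Sum>t. \<P>(w in \<Omega>. mistake t w))" ..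
  from incseq_convergent[OF incseq_regret this] show ?thesis by blast
qed

lemma better_ne_inferior_par:
  assumes g_arm: "g \<in> {1, 2}" and pref_g: "\<And>x. x \<in> Xs \<Longrightarrow> pref F C x = {g}"
    and v_better: "v \<in> better (par C g)"
  shows "v \<noteq> par C (3 - g)"
proof -
  obtain x where x_beats: "x \<in> Xs" "mu F v x > mu F (par C g) x"
    using v_better by (auto simp: better_def)
  have "g \<in> pref F C x" "3 - g \<in> {1, 2}" using g_arm by (auto simp: pref_g[OF x_beats(1)])
  then have "mu F (par C (3 - g)) x \<le> mu F (par C g) x" by (auto simp: pref_def)
  then show ?thesis using x_beats by auto
qed

lemma inferior_exploration_early_or_late:
  assumes g_arm: "g \<in> {1, 2}" and pref_g: "pref F C (Xo w t) = {g}" and k_pos: "0 < k"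
    and inferior: "inferior t w" and explores: "exploratory (arm\<^sub>D w t) C (past\<^sub>D w t) (Xo w t)"
  defines "x0 \<equiv> separating_context (par C (3 - g)) (par C g)"
  shows "early_exploration k (3 - g) x0 t w \<or>
    (\<exists>v\<in>better (par C g). late_exploration k (3 - g) x0 v t w)"
proof -
  have arm_eq: "arm\<^sub>D w t = 3 - g"
    using inferior allocate_arms[of "past\<^sub>D w t" "Xo w t"] g_arm unfolding pref_g arm_policy by auto
  then have "3 - arm\<^sub>D w t = g" using g_arm by auto
  then obtain v where "v \<in> better (par C g)" "\<not> rejected (3 - g) v (par C (3 - g)) (past\<^sub>D w t)"
    and "obs\<^sub>D w t \<in> {3 - g} \<times> {x0} \<times> UNIV"
    using explores arm_eq by (auto simp: exploratory_def obs_def x0_def)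
  then show ?thesis
    using k_pos by (auto simp: early_exploration_def late_exploration_def field_simps)
qed

lemma regret_le_ln_threshold:
  assumes g_arm: "g \<in> {1, 2}" and pref_g: "\<And>x. x \<in> Xs \<Longrightarrow> pref F C x = {g}" and k_pos: "0 < k"
    and KL_greater: "\<And>v. v \<in> better (par C g) \<Longrightarrow>
      ereal k < KLI F (par C (3 - g)) v (separating_context (par C (3 - g)) (par C g))"
  obtains B where "\<And>T. regret T \<le> B + ln (threshold T) / k"
proof -
  define x0 where "x0 = separating_context (par C (3 - g)) (par C g)"
  let ?early = "early_exploration k (3 - g) x0"
  define error where
    "error = (\<lambda>t w. mistake t w \<or> (\<exists>v\<in>better (par C g). late_exploration k (3 - g) x0 v t w))"
  have error: "Om.summable_events error"
    unfolding error_def x0_def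
    using better_ne_inferior_par[OF g_arm pref_g] KL_greater better_subset separating_context_in
    by (intro Om.summable_events_disj Om.summable_events_Bex summable_mistake finite_better
        summable_late_exploration) auto
  have "AE w in \<Omega>. inferior t w \<longrightarrow> ?early t w \<or> error t w" for t
    using AE_inferior[of t]
  proof eventually_elim
    case (elim w)
    then show ?case
      using inferior_exploration_early_or_late[OF g_arm pref_g k_pos]
      unfolding error_def x0_def by blast
  qed
  then have "regret T \<le> (\<Sum>t<T. \<P>(w in \<Omega>. ?early t w \<or> error t w))" for T
    using measurable_early_exploration error
    by (intro regret_le_sum_prob pred_intros_logic(5)) (auto simp: Om.summable_events_def)
  also have "(\<Sum>t<T. \<P>(w in \<Omega>. ?early t w \<or> error t w))
      \<le> (\<Sum>t<T. \<P>(w in \<Omega>. ?early t w)) + (\<Sum>t. \<P>(w in \<Omega>. error t w))" for T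
    by (rule Om.sum_prob_disj_summable_le[OF measurable_early_exploration error])
  also have "(\<Sum>t<T. \<P>(w in \<Omega>. ?early t w)) \<le> ln (threshold T) / k + 1" for T
    by (rule sum_prob_early_exploration_le[OF k_pos])
  finally show ?thesis
    by (intro that[of "1 + (\<Sum>t. \<P>(w in \<Omega>. error t w))"]) (simp add: algebra_simps)
qed

lemma Ksupinf_eq_separating_context:
  "Ksupinf F Th Xs b g = (INF v \<in> better g. KLI F b v (separating_context b g))"
  unfolding Ksupinf_def better_def[symmetric]
proof (rule antisym)
  show "(SUP x\<in>Xs. INF v\<in>better g. KLI F b v x)
      \<le> (INF v\<in>better g. KLI F b v (separating_context b g))"
    unfolding separating_context_def
    by (intro SUP_least arg_max_on_greatest[OF finite_contexts Xs_nonempty])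
qed (intro SUP_upper separating_context_in)

theorem limsup_regret_le:
  assumes g_arm: "g \<in> {1, 2}" and pref_g: "\<And>x. x \<in> Xs \<Longrightarrow> pref F C x = {g}"
  shows "limsup (\<lambda>t. ereal (regret t / ln (real t)))
    \<le> 1 / Ksupinf F Th Xs (par C (3 - g)) (par C g)"
proof (rule ereal_le_divide_1I)
  let ?K = "\<lambda>v. KLI F (par C (3 - g)) v (separating_context (par C (3 - g)) (par C g))"
  have "0 < ?K v" if "v \<in> better (par C g)" for v
    using that better_subset better_ne_inferior_par[OF g_arm pref_g that]
    by (intro KL_pos par_in separating_context_in) auto
  then show "0 < Ksupinf F Th Xs (par C (3 - g)) (par C g)"
    unfolding Ksupinf_eq_separating_context
    by (cases "better (par C g) = {}")
      (simp_all add: top_ereal_def finite_less_Inf_iff finite_better)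
  fix k assume k_between: "0 < k" "ereal k < Ksupinf F Th Xs (par C (3 - g)) (par C g)"
  then have "ereal k < ?K v" if "v \<in> better (par C g)" for v
    unfolding Ksupinf_eq_separating_context using that by (auto intro: less_le_trans INF_lower)
  then obtain B where "\<And>T. regret T \<le> B + ln (threshold T) / k"
    using regret_le_ln_threshold[OF g_arm pref_g k_between(1)] by blast
  then show "limsup (\<lambda>t. ereal (regret t / ln (real t))) \<le> ereal (1 / k)"
    by (rule limsup_div_ln_le)
qed

end

lemma (in bandit_family) bandit_problem_of_params:
  "th1 \<in> Th \<Longrightarrow> th2 \<in> Th \<Longrightarrow> bandit_problem Th Xs F G (th1, th2)"
  by unfold_locales simp_all

theorem theorem8:
  fixes Th Xs :: "real set" and F :: "real \<Rightarrow> real \<Rightarrow> real measure" and G :: "real pmf"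
  assumes kernel: "\<And>th x. th \<in> Th \<Longrightarrow> x \<in> Xs \<Longrightarrow>
              prob_space (F th x) \<and> sets (F th x) = sets borel \<and> integrable (F th x) (\<lambda>y. y)"
    and G_on_X: "set_pmf G \<subseteq> Xs"
    and X_fin: "finite Xs"
    and G_pos: "\<And>x. x \<in> Xs \<Longrightarrow> pmf G x > 0"
    and KL_pos_fin: "\<And>th vth x. th \<in> Th \<Longrightarrow> vth \<in> Th \<Longrightarrow> th \<noteq> vth \<Longrightarrow> x \<in> Xs \<Longrightarrow>
              0 < KLI F th vth x \<and> KLI F th vth x < \<infinity>"
    and Th_fin: "finite Th"
    and saddle2: "\<And>th1 th2. th1 \<in> Th \<Longrightarrow> th2 \<in> Th \<Longrightarrow> \<not> revealing F Xs (th1, th2) \<Longrightarrow>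
              (\<forall>x \<in> Xs. pref F (th1, th2) x = {2}) \<Longrightarrow>
              Kinfsup F Th Xs th1 th2 = Ksupinf F Th Xs th1 th2"
    and saddle1: "\<And>th1 th2. th1 \<in> Th \<Longrightarrow> th2 \<in> Th \<Longrightarrow> \<not> revealing F Xs (th1, th2) \<Longrightarrow>
              (\<forall>x \<in> Xs. pref F (th1, th2) x = {1}) \<Longrightarrow>
              Kinfsup F Th Xs th2 th1 = Ksupinf F Th Xs th2 th1"
  shows "\<exists>pol :: (real \<times> real) list \<Rightarrow> real \<Rightarrow> nat.
           (\<forall>h x. pol h x \<in> {1, 2}) \<and>
           (\<forall>t. (\<lambda>w. arm pol w t) \<in> stream_space borel \<rightarrow>\<^sub>M count_space UNIV) \<and>
           (\<forall>th1 \<in> Th. \<forall>th2 \<in> Th. revealing F Xs (th1, th2) \<longrightarrow>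
              (\<exists>L::real. (\<lambda>t. ETinf F G (th1, th2) pol t) \<longlonglongrightarrow> L)) \<and>
           (\<forall>th1 \<in> Th. \<forall>th2 \<in> Th. \<not> revealing F Xs (th1, th2) \<longrightarrow> th1 \<noteq> th2 \<longrightarrow>
              (\<forall>x \<in> Xs. pref F (th1, th2) x = {2}) \<longrightarrow>
              limsup (\<lambda>t. ereal (ETinf F G (th1, th2) pol t / ln (real t)))
                \<le> 1 / Kinfsup F Th Xs th1 th2) \<and>
           (\<forall>th1 \<in> Th. \<forall>th2 \<in> Th. \<not> revealing F Xs (th1, th2) \<longrightarrow> th1 \<noteq> th2 \<longrightarrow>
              (\<forall>x \<in> Xs. pref F (th1, th2) x = {1}) \<longrightarrow>
              limsup (\<lambda>t. ereal (ETinf F G (th1, th2) pol t / ln (real t)))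
                \<le> 1 / Kinfsup F Th Xs th2 th1)"
proof (cases "Th = {}")
  case True
  then show ?thesis by (intro exI[of _ "\<lambda>_ _. 1"]) (simp add: arm_def)
next
  case False
  interpret bandit_family Th Xs F G
    using kernel G_on_X X_fin G_pos KL_pos_fin Th_fin False by (intro bandit_family.intro) auto
  let ?rate = "\<lambda>th1 th2 t. ereal (ETinf F G (th1, th2) (policy allocate) t / ln (real t))"
  show ?thesis
  proof (intro exI[of _ "policy allocate"] conjI ballI allI impI)
    show "policy allocate h x \<in> {1, 2}" for h x unfolding policy_def by (rule allocate_arms)
    show "(\<lambda>w. arm (policy allocate) w t) \<in> stream_space borel \<rightarrow>\<^sub>M count_space UNIV" for t
      by (rule measurable_arm[OF measurable_allocate])
    fix th1 th2 assume params_in: "th1 \<in> Th" "th2 \<in> Th"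
    note revealing = bandit_problem.regret_converges_if_revealing[OF bandit_problem_of_params[OF params_in]]
      and nonrevealing = bandit_problem.limsup_regret_le[OF bandit_problem_of_params[OF params_in]]
    show "\<exists>L. ETinf F G (th1, th2) (policy allocate) \<longlonglongrightarrow> L" if "revealing F Xs (th1, th2)"
      by (rule revealing[OF that])
    assume not_revealing: "\<not> revealing F Xs (th1, th2)"
    show "limsup (?rate th1 th2) \<le> 1 / Kinfsup F Th Xs th1 th2"
      if "\<forall>x\<in>Xs. pref F (th1, th2) x = {2}"
      using nonrevealing[of 2] that saddle2[OF params_in not_revealing that] by (simp add: par_def)
    show "limsup (?rate th1 th2) \<le> 1 / Kinfsup F Th Xs th2 th1"
      if "\<forall>x\<in>Xs. pref F (th1, th2) x = {1}"
      using nonrevealing[of 1] that saddle1[OF params_in not_revealing that] by (simp add: par_def)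
  qed
qed

end
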